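(* Let $n\geq 1$. The ring $\Gamma^{(n)}:=\mathbb{Z}[{}^nc_1,{}^nc_2,\ldots]$ of theta polynomials of level $n$ is equal to the subring $\Gamma[X_n]^{W_n}$ of $W_n$-invariants in $\Gamma[X_n]$.
   Context: $c_1,c_2,\ldots$ are commuting variables, $c_0:=1$, $c_p:=0$ for $p<0$; $\Gamma$ is the quotient of $\mathbb{Z}[c_1,c_2,\ldots]$ by the relations $c_p^2+2\sum_{i=1}^p(-1)^ic_{p+i}c_{p-i}=0$ for all $p\geq 1$. $X_n=(x_1,\ldots,x_n)$ are independent variables. For $p\geq1$, ${}^nc_p:=\sum_{j=0}^pc_{p-j}e_j(X_n)\in\Gamma[X_n]$, where $e_j(X_n)$ is the $j$-th elementary symmetric polynomial. $W_n$ is the group of signed permutations of $\{1,\ldots,n\}$, generated by the transpositions $s_i=(i,i+1)$, $1\leq i\leq n-1$, and the sign change $s_0$ of $1$. It acts on $\Gamma[X_n]$ by ring automorphisms: $s_i$ ($i\geq1$) interchanges $x_i$ and $x_{i+1}$ and fixes the other $x_j$ and all $c_p$; $s_0$ sends $x_1\mapsto-x_1$, fixes $x_j$ for $j\geq2$, and $s_0(c_p)=c_p+2\sum_{j=1}^px_1^jc_{p-j}$ for all $p\geq1$. *)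

theory Defs
  imports
    "HOL-Library.Poly_Mapping"
    "HOL-Combinatorics.Permutations"
    "HOL-Computational_Algebra.Formal_Power_Series"
begin

section \<open>Polynomials over a commutative ring\<close>

(* Polynomials in variables indexed by all natural numbers; finite variable sets are cut out by
   a carrier set (see gamma_polys below). *)
type_synonym 'a mpoly = "(nat \<Rightarrow>\<^sub>0 nat) \<Rightarrow>\<^sub>0 'a"

definition PVar :: "nat \<Rightarrow> 'a::comm_ring_1 mpoly" where
  "PVar i = Poly_Mapping.single (Poly_Mapping.single i 1) 1"

definition PConst :: "'a::comm_ring_1 \<Rightarrow> 'a mpoly" where
  "PConst a = Poly_Mapping.single 0 a"

definition subring_set :: "'a::comm_ring_1 set \<Rightarrow> bool" where
  "subring_set A \<longleftrightarrow> 1 \<in> A \<and> (\<forall>a\<in>A. \<forall>b\<in>A. a - b \<in> A \<and> a * b \<in> A)"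

definition generated_subring :: "'a::comm_ring_1 set \<Rightarrow> 'a set" where
  "generated_subring S = \<Inter>{A. subring_set A \<and> S \<subseteq> A}"

definition ring_hom_on :: "'a::comm_ring_1 set \<Rightarrow> ('a \<Rightarrow> 'b::comm_ring_1) \<Rightarrow> bool" where
  "ring_hom_on A h \<longleftrightarrow> h 1 = 1 \<and> (\<forall>a\<in>A. \<forall>b\<in>A. h (a + b) = h a + h b \<and> h (a * b) = h a * h b)"

definition ring_automorphism_on :: "'a::comm_ring_1 set \<Rightarrow> ('a \<Rightarrow> 'a) \<Rightarrow> bool" where
  "ring_automorphism_on A h \<longleftrightarrow> bij_betw h A A \<and> ring_hom_on A h"

lemma subring_setD:
  assumes "subring_set A"
  shows "1 \<in> A" "0 \<in> A" "a \<in> A \<Longrightarrow> b \<in> A \<Longrightarrow> a - b \<in> A"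
    "a \<in> A \<Longrightarrow> - a \<in> A"
    "a \<in> A \<Longrightarrow> b \<in> A \<Longrightarrow> a + b \<in> A" "a \<in> A \<Longrightarrow> b \<in> A \<Longrightarrow> a * b \<in> A"
proof -
  have 1: "1 \<in> A" and m: "\<And>a b. a \<in> A \<Longrightarrow> b \<in> A \<Longrightarrow> a - b \<in> A"
    and t: "\<And>a b. a \<in> A \<Longrightarrow> b \<in> A \<Longrightarrow> a * b \<in> A"
    using assms by (auto simp: subring_set_def)
  have 0: "0 \<in> A" using m[OF 1 1] by simp
  have n: "- a \<in> A" if "a \<in> A" for a using m[OF 0 that] by simp
  have p: "a + b \<in> A" if "a \<in> A" "b \<in> A" for a b using m[OF that(1) n[OF that(2)]] by simp
  show "1 \<in> A" "0 \<in> A" "a \<in> A \<Longrightarrow> b \<in> A \<Longrightarrow> a - b \<in> A"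
    "a \<in> A \<Longrightarrow> - a \<in> A"
    "a \<in> A \<Longrightarrow> b \<in> A \<Longrightarrow> a + b \<in> A" "a \<in> A \<Longrightarrow> b \<in> A \<Longrightarrow> a * b \<in> A"
    by (fact 1 0 m n p t)+
qed

lemma subring_set_sum: "subring_set A \<Longrightarrow> (\<And>i. i \<in> I \<Longrightarrow> f i \<in> A) \<Longrightarrow> sum f I \<in> A"
  by (induction I rule: infinite_finite_induct) (auto intro: subring_setD)

lemma subring_set_prod: "subring_set A \<Longrightarrow> (\<And>i. i \<in> I \<Longrightarrow> f i \<in> A) \<Longrightarrow> prod f I \<in> A"
  by (induction I rule: infinite_finite_induct) (auto intro: subring_setD)

lemma subring_set_power: "subring_set A \<Longrightarrow> a \<in> A \<Longrightarrow> a ^ k \<in> A"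
  by (induction k) (auto intro: subring_setD)

lemma subring_set_of_nat: "subring_set A \<Longrightarrow> of_nat k \<in> A"
  by (induction k) (auto intro: subring_setD)

lemma subring_set_of_int: "subring_set A \<Longrightarrow> of_int k \<in> A"
  by (cases k) (auto intro!: subring_setD subring_set_of_nat simp flip: of_nat_Suc)

lemma subring_set_UNIV: "subring_set UNIV"
  by (simp add: subring_set_def)

lemma ring_hom_onD:
  assumes "ring_hom_on A h" "subring_set A"
  shows "h 1 = 1" "h 0 = 0" "a \<in> A \<Longrightarrow> h (- a) = - h a"
    "a \<in> A \<Longrightarrow> b \<in> A \<Longrightarrow> h (a + b) = h a + h b"
    "a \<in> A \<Longrightarrow> b \<in> A \<Longrightarrow> h (a - b) = h a - h b"
    "a \<in> A \<Longrightarrow> b \<in> A \<Longrightarrow> h (a * b) = h a * h b"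
proof -
  note A = subring_setD[OF assms(2)]
  have 1: "h 1 = 1" and p: "\<And>a b. a \<in> A \<Longrightarrow> b \<in> A \<Longrightarrow> h (a + b) = h a + h b"
    and t: "\<And>a b. a \<in> A \<Longrightarrow> b \<in> A \<Longrightarrow> h (a * b) = h a * h b"
    using assms by (auto simp: ring_hom_on_def)
  have 0: "h 0 = 0" using p[OF A(2) A(2)] by simp
  have n: "h (- a) = - h a" if "a \<in> A" for a
    using p[OF that A(4)[OF that]] 0 by (simp add: add_eq_0_iff)
  have m: "h (a - b) = h a - h b" if "a \<in> A" "b \<in> A" for a b
    using p[OF that(1) A(4)[OF that(2)]] n[OF that(2)] by simp
  show "h 1 = 1" "h 0 = 0" "a \<in> A \<Longrightarrow> h (- a) = - h a"
    "a \<in> A \<Longrightarrow> b \<in> A \<Longrightarrow> h (a + b) = h a + h b"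
    "a \<in> A \<Longrightarrow> b \<in> A \<Longrightarrow> h (a - b) = h a - h b"
    "a \<in> A \<Longrightarrow> b \<in> A \<Longrightarrow> h (a * b) = h a * h b"
    by (fact 1 0 n p m t)+
qed

lemmas homD = ring_hom_onD[OF _ subring_set_UNIV, simplified]

lemma hom_sum: "ring_hom_on UNIV h \<Longrightarrow> h (sum f I) = (\<Sum>i\<in>I. h (f i))"
  by (induction I rule: infinite_finite_induct) (auto simp: homD)

lemma hom_prod: "ring_hom_on UNIV h \<Longrightarrow> h (prod f I) = (\<Prod>i\<in>I. h (f i))"
  by (induction I rule: infinite_finite_induct) (auto simp: homD)

lemma hom_power: "ring_hom_on UNIV h \<Longrightarrow> h (a ^ k) = h a ^ k"
  by (induction k) (auto simp: homD)

lemma hom_two: "ring_hom_on UNIV h \<Longrightarrow> h 2 = 2"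
  using homD(4)[of h 1 1] homD(1)[of h] by simp

lemma hom_vimage_subring:
  assumes "ring_hom_on UNIV h" "subring_set A"
  shows "subring_set {a. h a \<in> A}"
  using assms unfolding subring_set_def by (auto simp: homD)

lemma hom_equalizer_subring:
  assumes "ring_hom_on A f" "ring_hom_on A g" "subring_set A"
  shows "subring_set {a \<in> A. f a = g a}"
  unfolding subring_set_def
  by (auto simp: ring_hom_onD[OF assms(1,3)] ring_hom_onD[OF assms(2,3)] subring_setD[OF assms(3)])

definition monom_eval :: "(nat \<Rightarrow> 'b::comm_ring_1) \<Rightarrow> (nat \<Rightarrow>\<^sub>0 nat) \<Rightarrow> 'b" where
  "monom_eval g m = (\<Prod>i\<in>Poly_Mapping.keys m. g i ^ Poly_Mapping.lookup m i)"

definition poly_eval :: "('a::comm_ring_1 \<Rightarrow> 'b::comm_ring_1) \<Rightarrow> (nat \<Rightarrow> 'b) \<Rightarrow> 'a mpoly \<Rightarrow> 'b" where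
  "poly_eval h g p =
     (\<Sum>m\<in>Poly_Mapping.keys p. h (Poly_Mapping.lookup p m) * monom_eval g m)"

lemma monom_eval_superset:
  assumes "finite A" "Poly_Mapping.keys m \<subseteq> A"
  shows "monom_eval g m = (\<Prod>i\<in>A. g i ^ Poly_Mapping.lookup m i)"
  unfolding monom_eval_def
  by (rule prod.mono_neutral_left) (use assms in \<open>auto simp: in_keys_iff\<close>)

lemma monom_eval_add: "monom_eval g (m + m') = monom_eval g m * monom_eval g m'"
proof -
  let ?A = "Poly_Mapping.keys m \<union> Poly_Mapping.keys m'"
  have "monom_eval g (m + m') = (\<Prod>i\<in>?A. g i ^ Poly_Mapping.lookup (m + m') i)"
    by (rule monom_eval_superset) (simp_all add: keys_add)
  also have "\<dots> = (\<Prod>i\<in>?A. g i ^ Poly_Mapping.lookup m i) * (\<Prod>i\<in>?A. g i ^ Poly_Mapping.lookup m' i)"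
    by (simp add: lookup_add power_add prod.distrib)
  also have "\<dots> = monom_eval g m * monom_eval g m'"
    by (subst (1 2) monom_eval_superset[of ?A]) auto
  finally show ?thesis .
qed

lemma monom_eval_0 [simp]: "monom_eval g 0 = 1"
  by (simp add: monom_eval_def)

lemma monom_eval_single [simp]: "monom_eval g (Poly_Mapping.single i k) = g i ^ k"
  by (subst monom_eval_superset[of "{i}"]) (auto split: if_splits)

lemma poly_mapping_eq_sum_single:
  fixes p :: "'k \<Rightarrow>\<^sub>0 'a::comm_monoid_add"
  shows "p = (\<Sum>m\<in>Poly_Mapping.keys p. Poly_Mapping.single m (Poly_Mapping.lookup p m))"
proof (rule poly_mapping_eqI)
  fix k
  show "Poly_Mapping.lookup p k = Poly_Mapping.lookup
    (\<Sum>m\<in>Poly_Mapping.keys p. Poly_Mapping.single m (Poly_Mapping.lookup p m)) k"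
    by (simp add: lookup_sum lookup_single when_def in_keys_iff)
qed

lemma poly_eval_superset:
  assumes "h 0 = 0" "finite A" "Poly_Mapping.keys p \<subseteq> A"
  shows "poly_eval h g p = (\<Sum>m\<in>A. h (Poly_Mapping.lookup p m) * monom_eval g m)"
  unfolding poly_eval_def
  by (rule sum.mono_neutral_left) (use assms in \<open>auto simp: in_keys_iff\<close>)

lemma poly_eval_single:
  assumes "h 0 = 0"
  shows "poly_eval h g (Poly_Mapping.single m a) = h a * monom_eval g m"
  by (subst poly_eval_superset[of _ "{m}"]) (use assms in \<open>auto split: if_splits\<close>)

lemma poly_eval_add:
  assumes "ring_hom_on UNIV h"
  shows "poly_eval h g (p + q) = poly_eval h g p + poly_eval h g q"
proof -
  let ?A = "Poly_Mapping.keys p \<union> Poly_Mapping.keys q"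
  have "poly_eval h g (p + q) = (\<Sum>m\<in>?A. h (Poly_Mapping.lookup (p + q) m) * monom_eval g m)"
    by (rule poly_eval_superset) (simp_all add: keys_add homD[OF assms])
  also have "\<dots> = (\<Sum>m\<in>?A. h (Poly_Mapping.lookup p m) * monom_eval g m)
      + (\<Sum>m\<in>?A. h (Poly_Mapping.lookup q m) * monom_eval g m)"
    by (simp add: lookup_add homD[OF assms] ring_distribs sum.distrib)
  also have "\<dots> = poly_eval h g p + poly_eval h g q"
    by (subst (1 2) poly_eval_superset[of h ?A]) (auto simp: homD[OF assms])
  finally show ?thesis .
qed

lemma poly_eval_sum:
  assumes "ring_hom_on UNIV h"
  shows "poly_eval h g (sum f I) = (\<Sum>i\<in>I. poly_eval h g (f i))"
proof -
  have [simp]: "poly_eval h g 0 = 0" by (simp add: poly_eval_def)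
  show ?thesis
    by (induction I rule: infinite_finite_induct) (simp_all add: poly_eval_add[OF assms])
qed

lemma poly_eval_mult:
  assumes "ring_hom_on UNIV h"
  shows "poly_eval h g (p * q) = poly_eval h g p * poly_eval h g q"
proof -
  let ?s = "\<lambda>p m. Poly_Mapping.single m (Poly_Mapping.lookup p m)"
  note h = homD[OF assms]
  have "poly_eval h g (p * q) = poly_eval h g
      ((\<Sum>m\<in>Poly_Mapping.keys p. ?s p m) * (\<Sum>m\<in>Poly_Mapping.keys q. ?s q m))"
    by (simp flip: poly_mapping_eq_sum_single)
  also have "\<dots> = (\<Sum>m\<in>Poly_Mapping.keys p. \<Sum>m'\<in>Poly_Mapping.keys q.
      poly_eval h g (?s p m * ?s q m'))"
    by (simp add: sum_product poly_eval_sum[OF assms])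
  also have "\<dots> = (\<Sum>m\<in>Poly_Mapping.keys p. \<Sum>m'\<in>Poly_Mapping.keys q.
      (h (Poly_Mapping.lookup p m) * monom_eval g m)
      * (h (Poly_Mapping.lookup q m') * monom_eval g m'))"
    by (simp add: mult_single poly_eval_single h monom_eval_add ac_simps)
  also have "\<dots> = poly_eval h g p * poly_eval h g q"
    by (simp add: sum_product poly_eval_def)
  finally show ?thesis .
qed

lemma poly_eval_PConst: "ring_hom_on UNIV h \<Longrightarrow> poly_eval h g (PConst a) = h a"
  by (simp add: PConst_def poly_eval_single homD)

lemma poly_eval_PVar: "ring_hom_on UNIV h \<Longrightarrow> poly_eval h g (PVar i) = g i"
  by (simp add: PVar_def poly_eval_single homD)

lemma PConst_1 [simp]: "PConst 1 = 1"
  by (simp add: PConst_def)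

lemma poly_eval_hom:
  assumes "ring_hom_on UNIV h"
  shows "ring_hom_on UNIV (poly_eval h g)"
  using poly_eval_PConst[OF assms, of g 1] homD(1)[OF assms]
  by (simp add: ring_hom_on_def poly_eval_add[OF assms] poly_eval_mult[OF assms])

lemma PConst_hom: "ring_hom_on UNIV PConst"
  by (simp add: ring_hom_on_def PConst_def single_add mult_single)

lemma PVar_power: "PVar i ^ k = Poly_Mapping.single (Poly_Mapping.single i k) 1"
  by (induction k) (simp_all add: PVar_def mult_single flip: single_add)

lemma prod_single:
  "finite I \<Longrightarrow> (\<Prod>i\<in>I. Poly_Mapping.single (f i) (1::'a::comm_ring_1))
     = Poly_Mapping.single (\<Sum>i\<in>I. f i) 1"
  by (induction I rule: finite_induct) (auto simp: mult_single)

lemma single_eq_monomial: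
  "Poly_Mapping.single m a
     = PConst a * (\<Prod>i\<in>Poly_Mapping.keys m. PVar i ^ Poly_Mapping.lookup m i)"
  by (simp add: PVar_power prod_single PConst_def mult_single flip: poly_mapping_eq_sum_single)

lemma mpoly_in_subring:
  assumes "subring_set S" "\<And>a. PConst a \<in> S"
    and "\<And>m i. m \<in> Poly_Mapping.keys f \<Longrightarrow> i \<in> Poly_Mapping.keys m \<Longrightarrow> PVar i \<in> S"
  shows "f \<in> S"
proof -
  have "(\<Sum>m\<in>Poly_Mapping.keys f. Poly_Mapping.single m (Poly_Mapping.lookup f m)) \<in> S"
    unfolding single_eq_monomial
    by (intro subring_set_sum subring_set_prod subring_set_power subring_setD assms)
  then show ?thesis by (simp flip: poly_mapping_eq_sum_single)
qed


section \<open>The ring \<open>\<Gamma>\<close>\<close>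

(* The variable with index p - 1 plays the role of c_p (p >= 1), so that the polynomial ring has
   no superfluous variable. *)
definition csym :: "nat \<Rightarrow> int mpoly" where
  "csym p = (if p = 0 then 1 else PVar (p - 1))"

definition gamma_relation :: "nat \<Rightarrow> int mpoly" where
  "gamma_relation p = csym p ^ 2 + 2 * (\<Sum>i=1..p. (-1) ^ i * csym (p + i) * csym (p - i))"

(* module.span over the ring itself is the generated ideal. *)
definition gamma_ideal :: "int mpoly set" where
  "gamma_ideal = module.span (*) (gamma_relation ` {1..})"

lemma module_self: "module ((*) :: 'a::comm_ring_1 \<Rightarrow> 'a \<Rightarrow> 'a)"
  by unfold_locales (simp_all add: algebra_simps)

lemma gamma_ideal:
  "0 \<in> gamma_ideal" "a \<in> gamma_ideal \<Longrightarrow> b \<in> gamma_ideal \<Longrightarrow> a + b \<in> gamma_ideal"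
  "a \<in> gamma_ideal \<Longrightarrow> b \<in> gamma_ideal \<Longrightarrow> a - b \<in> gamma_ideal"
  "a \<in> gamma_ideal \<Longrightarrow> - a \<in> gamma_ideal" "b \<in> gamma_ideal \<Longrightarrow> a * b \<in> gamma_ideal"
  "b \<in> gamma_ideal \<Longrightarrow> b * a \<in> gamma_ideal"
  unfolding gamma_ideal_def
  using module.span_zero[OF module_self] module.span_add[OF module_self]
    module.span_diff[OF module_self] module.span_neg[OF module_self]
    module.span_scale[OF module_self]
  by (auto simp: mult.commute[of b])

lemma gamma_ideal_kernel:
  assumes h: "ring_hom_on UNIV h" and r: "\<And>p. p \<ge> 1 \<Longrightarrow> h (gamma_relation p) = 0"
    and a: "a \<in> gamma_ideal"
  shows "h a = 0"
proof -
  have "gamma_ideal \<subseteq> {a. h a = 0}"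
    unfolding gamma_ideal_def
    by (rule module.span_minimal[OF module_self])
      (auto simp: module.subspace_def[OF module_self] homD[OF h] r)
  with a show ?thesis by auto
qed

lemma one_notin_gamma_ideal: "1 \<notin> gamma_ideal"
proof
  assume 1: "1 \<in> gamma_ideal"
  have id: "ring_hom_on UNIV (id :: int \<Rightarrow> int)" by (simp add: ring_hom_on_def)
  let ?h = "poly_eval (id :: int \<Rightarrow> int) (\<lambda>_. 0)"
  have h: "ring_hom_on UNIV ?h" by (rule poly_eval_hom[OF id])
  have c: "?h (csym p) = 0" if "p \<ge> 1" for p
    using that by (simp add: csym_def poly_eval_PVar[OF id])
  have "?h (gamma_relation p) = 0" if "p \<ge> 1" for p
    using that by (simp add: gamma_relation_def homD[OF h] hom_sum[OF h] hom_power[OF h] c)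
  from gamma_ideal_kernel[OF h this 1] show False
    unfolding homD(1)[OF h] by simp
qed

quotient_type gamma = "int mpoly" / "\<lambda>a b. a - b \<in> gamma_ideal"
proof (rule equivpI)
  show "reflp (\<lambda>a b. a - b \<in> gamma_ideal)" by (simp add: reflp_def gamma_ideal)
  show "symp (\<lambda>a b. a - b \<in> gamma_ideal)"
  proof (rule sympI)
    fix a b :: "int mpoly" assume "a - b \<in> gamma_ideal"
    from gamma_ideal(4)[OF this] show "b - a \<in> gamma_ideal" by simp
  qed
  show "transp (\<lambda>a b. a - b \<in> gamma_ideal)"
  proof (rule transpI)
    fix a b c :: "int mpoly" assume "a - b \<in> gamma_ideal" "b - c \<in> gamma_ideal"
    from gamma_ideal(2)[OF this] show "a - c \<in> gamma_ideal" by simp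
  qed
qed

lemma gamma_exhaust: "\<exists>q. a = abs_gamma q"
  by (rule gamma.abs_induct[of _ a]) blast

instantiation gamma :: comm_ring_1
begin

lift_definition zero_gamma :: gamma is 0 .
lift_definition one_gamma :: gamma is 1 .
lift_definition plus_gamma :: "gamma \<Rightarrow> gamma \<Rightarrow> gamma" is "(+)"
proof -
  fix a b c d :: "int mpoly" assume "a - b \<in> gamma_ideal" "c - d \<in> gamma_ideal"
  from gamma_ideal(2)[OF this] show "a + c - (b + d) \<in> gamma_ideal" by (simp add: algebra_simps)
qed
lift_definition minus_gamma :: "gamma \<Rightarrow> gamma \<Rightarrow> gamma" is "(-)"
proof -
  fix a b c d :: "int mpoly" assume "a - b \<in> gamma_ideal" "c - d \<in> gamma_ideal"
  from gamma_ideal(3)[OF this] show "a - c - (b - d) \<in> gamma_ideal" by (simp add: algebra_simps)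
qed
lift_definition uminus_gamma :: "gamma \<Rightarrow> gamma" is uminus
proof -
  fix a b :: "int mpoly" assume "a - b \<in> gamma_ideal"
  from gamma_ideal(4)[OF this] show "- a - - b \<in> gamma_ideal" by (simp add: algebra_simps)
qed
lift_definition times_gamma :: "gamma \<Rightarrow> gamma \<Rightarrow> gamma" is "(*)"
proof -
  fix a b c d :: "int mpoly" assume "a - b \<in> gamma_ideal" "c - d \<in> gamma_ideal"
  then have "(a - b) * c + b * (c - d) \<in> gamma_ideal"
    by (intro gamma_ideal(2) gamma_ideal(5) gamma_ideal(6))
  then show "a * c - b * d \<in> gamma_ideal" by (simp add: algebra_simps)
qed

instance
proof
  fix a b c :: gamma
  obtain a' where a: "a = abs_gamma a'" using gamma_exhaust by blast
  obtain b' where b: "b = abs_gamma b'" using gamma_exhaust by blast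
  obtain c' where c: "c = abs_gamma c'" using gamma_exhaust by blast
  note abs_eqs = a b c zero_gamma.abs_eq one_gamma.abs_eq plus_gamma.abs_eq minus_gamma.abs_eq
    uminus_gamma.abs_eq times_gamma.abs_eq
  show "a + b + c = a + (b + c)" "a + b = b + a" "0 + a = a" "- a + a = 0" "a - b = a + - b"
    "a * b * c = a * (b * c)" "a * b = b * a" "1 * a = a" "(a + b) * c = a * c + b * c"
    unfolding abs_eqs by (simp_all add: algebra_simps)
  show "(0::gamma) \<noteq> 1"
    using one_notin_gamma_ideal gamma_ideal(4)[of "-1"]
    by (auto simp: zero_gamma.abs_eq one_gamma.abs_eq gamma.abs_eq_iff)
qed

end

(* The class of c_p. *)
lift_definition gamma_c :: "nat \<Rightarrow> gamma" is csym .


section \<open>The ring \<open>\<Gamma>[X\<^sub>n]\<close> and theta polynomials\<close>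

definition gamma_polys :: "nat \<Rightarrow> gamma mpoly set" where
  "gamma_polys n = {f. \<forall>m\<in>Poly_Mapping.keys f. Poly_Mapping.keys m \<subseteq> {1..n}}"

abbreviation X :: "nat \<Rightarrow> gamma mpoly" where "X \<equiv> PVar"

abbreviation C :: "nat \<Rightarrow> gamma mpoly" where "C p \<equiv> PConst (gamma_c p)"

definition elem_sym :: "nat \<Rightarrow> nat \<Rightarrow> gamma mpoly" where
  "elem_sym n j = (\<Sum>S | S \<subseteq> {1..n} \<and> card S = j. \<Prod>i\<in>S. X i)"

definition theta_c :: "nat \<Rightarrow> nat \<Rightarrow> gamma mpoly" where
  "theta_c n p = (\<Sum>j=0..p. C (p - j) * elem_sym n j)"

definition theta_ring :: "nat \<Rightarrow> gamma mpoly set" where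
  "theta_ring n = generated_subring (theta_c n ` {1..})"


section \<open>The action of the group of signed permutations\<close>

(* A signed permutation is an odd permutation of {-n..n}, extended by the identity. *)
definition signed_perms :: "nat \<Rightarrow> (int \<Rightarrow> int) set" where
  "signed_perms n = {w. w permutes {- int n..int n} \<and> (\<forall>i. w (- i) = - w i)}"

(* Transpositions are mirrored on the negative half so as to commute with negation. *)
definition simple_refl :: "nat \<Rightarrow> int \<Rightarrow> int" where
  "simple_refl i = (if i = 0 then transpose 1 (- 1)
     else transpose (int i) (int i + 1) \<circ> transpose (- int i) (- (int i + 1)))"

(* phi is a left action of signed_perms n on the ring gamma_polys n by ring automorphisms with the
   prescribed values on the generators. *)
definition is_weyl_action :: "nat \<Rightarrow> ((int \<Rightarrow> int) \<Rightarrow> gamma mpoly \<Rightarrow> gamma mpoly) \<Rightarrow> bool" where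
  "is_weyl_action n \<phi> \<longleftrightarrow>
     (\<forall>w\<in>signed_perms n. ring_automorphism_on (gamma_polys n) (\<phi> w)) \<and>
     (\<forall>f\<in>gamma_polys n. \<phi> id f = f) \<and>
     (\<forall>v\<in>signed_perms n. \<forall>w\<in>signed_perms n. \<forall>f\<in>gamma_polys n. \<phi> (v \<circ> w) f = \<phi> v (\<phi> w f)) \<and>
     (\<forall>i\<in>{1..<n}.
        \<phi> (simple_refl i) (X i) = X (i + 1) \<and>
        \<phi> (simple_refl i) (X (i + 1)) = X i \<and>
        (\<forall>j\<in>{1..n} - {i, i + 1}. \<phi> (simple_refl i) (X j) = X j) \<and>
        (\<forall>p\<ge>1. \<phi> (simple_refl i) (C p) = C p)) \<and>
     \<phi> (simple_refl 0) (X 1) = - X 1 \<and>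
     (\<forall>j\<in>{2..n}. \<phi> (simple_refl 0) (X j) = X j) \<and>
     (\<forall>p\<ge>1. \<phi> (simple_refl 0) (C p) = C p + 2 * (\<Sum>j=1..p. X 1 ^ j * C (p - j)))"

(* For n >= 1 such an action exists and is unique on signed_perms n and gamma_polys n: see is_weyl_action_weyl_action and weyl_action_unique below. *)
definition weyl_action :: "nat \<Rightarrow> (int \<Rightarrow> int) \<Rightarrow> gamma mpoly \<Rightarrow> gamma mpoly" where
  "weyl_action n = (SOME \<phi>. is_weyl_action n \<phi>)"

definition weyl_invariants :: "nat \<Rightarrow> gamma mpoly set" where
  "weyl_invariants n = {f \<in> gamma_polys n. \<forall>w\<in>signed_perms n. weyl_action n w f = f}"


section \<open>Existence and uniqueness of the action\<close>

subsection \<open>Homomorphisms out of \<open>\<Gamma>\<close> and \<open>\<Gamma>[X\<^sub>n]\<close>\<close>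

definition gamma_seq :: "(nat \<Rightarrow> 'b::comm_ring_1) \<Rightarrow> bool" where
  "gamma_seq d \<longleftrightarrow> d 0 = 1 \<and>
     (\<forall>p\<ge>1. d p ^ 2 + 2 * (\<Sum>i=1..p. (-1) ^ i * d (p + i) * d (p - i)) = 0)"

lemma gamma_seqD:
  assumes "gamma_seq d"
  shows "d 0 = 1"
    and "p \<ge> 1 \<Longrightarrow> d p ^ 2 + 2 * (\<Sum>i=1..p. (-1) ^ i * d (p + i) * d (p - i)) = 0"
  using assms unfolding gamma_seq_def by blast+

definition gamma_eval :: "(nat \<Rightarrow> 'b::comm_ring_1) \<Rightarrow> gamma \<Rightarrow> 'b" where
  "gamma_eval d a = poly_eval of_int (\<lambda>i. d (Suc i)) (rep_gamma a)"

lemma of_int_hom: "ring_hom_on UNIV (of_int :: int \<Rightarrow> 'b::comm_ring_1)"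
  by (simp add: ring_hom_on_def)

lemma gamma_eval_abs:
  assumes "gamma_seq d"
  shows "gamma_eval d (abs_gamma q) = poly_eval of_int (\<lambda>i. d (Suc i)) q"
proof -
  let ?h = "poly_eval of_int (\<lambda>i. d (Suc i))"
  have h: "ring_hom_on UNIV ?h" by (rule poly_eval_hom[OF of_int_hom])
  have c: "?h (csym p) = d p" for p
    using gamma_seqD(1)[OF assms] by (simp add: csym_def poly_eval_PVar[OF of_int_hom] homD[OF h])
  have "?h (gamma_relation p) = 0" if "p \<ge> 1" for p
  proof -
    have "?h (gamma_relation p) = d p ^ 2 + 2 * (\<Sum>i=1..p. (-1) ^ i * d (p + i) * d (p - i))"
      by (simp add: gamma_relation_def homD[OF h] hom_sum[OF h] hom_power[OF h] hom_two[OF h] c)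
    then show ?thesis using gamma_seqD(2)[OF assms that] by simp
  qed
  moreover have "rep_gamma (abs_gamma q) - q \<in> gamma_ideal"
    using Quotient3_abs_rep[OF Quotient3_gamma, of "abs_gamma q"] by (simp only: gamma.abs_eq_iff)
  ultimately have "?h (rep_gamma (abs_gamma q) - q) = 0"
    using gamma_ideal_kernel[OF h] by blast
  then show ?thesis unfolding gamma_eval_def homD(5)[OF h] by (rule eq_iff_diff_eq_0[THEN iffD2])
qed

lemma gamma_eval_hom:
  assumes "gamma_seq d"
  shows "ring_hom_on UNIV (gamma_eval d)"
  unfolding ring_hom_on_def
proof (intro conjI ballI)
  let ?h = "poly_eval of_int (\<lambda>i. d (Suc i))"
  have h: "ring_hom_on UNIV ?h" by (rule poly_eval_hom[OF of_int_hom])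
  show "gamma_eval d 1 = 1"
    by (simp add: one_gamma.abs_eq gamma_eval_abs[OF assms] homD[OF h])
  fix a b :: gamma
  obtain a' where a: "a = abs_gamma a'" using gamma_exhaust by blast
  obtain b' where b: "b = abs_gamma b'" using gamma_exhaust by blast
  show "gamma_eval d (a + b) = gamma_eval d a + gamma_eval d b"
    "gamma_eval d (a * b) = gamma_eval d a * gamma_eval d b"
    by (simp_all add: a b plus_gamma.abs_eq times_gamma.abs_eq gamma_eval_abs[OF assms] homD[OF h])
qed

lemma gamma_eval_gamma_c:
  assumes "gamma_seq d"
  shows "gamma_eval d (gamma_c p) = d p"
proof -
  have h: "ring_hom_on UNIV (poly_eval of_int (\<lambda>i. d (Suc i)))"
    by (rule poly_eval_hom[OF of_int_hom])
  have "poly_eval of_int (\<lambda>i. d (Suc i)) (csym p) = d p"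
    using gamma_seqD(1)[OF assms] by (simp add: csym_def poly_eval_PVar[OF of_int_hom] homD[OF h])
  then show ?thesis unfolding gamma_c.abs_eq gamma_eval_abs[OF assms] .
qed

lemma abs_gamma_hom: "ring_hom_on UNIV abs_gamma"
  by (simp add: ring_hom_on_def one_gamma.abs_eq plus_gamma.abs_eq times_gamma.abs_eq)

lemma gamma_c_0 [simp]: "gamma_c 0 = 1"
  by (simp add: gamma_c.abs_eq csym_def one_gamma.abs_eq)

lemma gamma_seq_gamma_c: "gamma_seq gamma_c"
  unfolding gamma_seq_def
proof (intro conjI allI impI)
  fix p :: nat assume "1 \<le> p"
  then have "gamma_relation p \<in> gamma_ideal"
    unfolding gamma_ideal_def by (intro module.span_base[OF module_self]) auto
  then have "abs_gamma (gamma_relation p) = 0"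
    by (simp add: zero_gamma.abs_eq gamma.abs_eq_iff)
  moreover have "abs_gamma (gamma_relation p)
      = gamma_c p ^ 2 + 2 * (\<Sum>i=1..p. (-1) ^ i * gamma_c (p + i) * gamma_c (p - i))"
    by (simp add: gamma_relation_def homD[OF abs_gamma_hom] hom_sum[OF abs_gamma_hom]
        hom_power[OF abs_gamma_hom] hom_two[OF abs_gamma_hom] gamma_c.abs_eq)
  ultimately show "gamma_c p ^ 2 + 2 * (\<Sum>i=1..p. (-1) ^ i * gamma_c (p + i) * gamma_c (p - i)) = 0"
    by simp
qed simp

lemma gamma_polys_subset:
  assumes S: "subring_set S" and c: "\<And>p. p \<ge> 1 \<Longrightarrow> C p \<in> S"
    and x: "\<And>i. i \<in> {1..n} \<Longrightarrow> X i \<in> S"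
  shows "gamma_polys n \<subseteq> S"
proof
  fix f assume f: "f \<in> gamma_polys n"
  have const: "PConst a \<in> S" for a
  proof -
    let ?T = "{q. PConst (abs_gamma q) \<in> S}"
    have h: "ring_hom_on UNIV (\<lambda>q. PConst (abs_gamma q))"
      by (simp add: ring_hom_on_def homD[OF abs_gamma_hom] homD[OF PConst_hom])
    have T: "subring_set ?T" by (rule hom_vimage_subring[OF h S])
    have "q \<in> ?T" for q
    proof (rule mpoly_in_subring[OF T])
      fix k :: int
      have "PConst k = (of_int k :: int mpoly)"
        by (simp add: PConst_def flip: single_of_int)
      then show "PConst k \<in> ?T" using subring_set_of_int[OF T] by metis
    next
      fix i
      show "PVar i \<in> ?T" using c[of "Suc i"] by (simp add: gamma_c.abs_eq csym_def)
    qed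
    moreover obtain q where "a = abs_gamma q" using gamma_exhaust by blast
    ultimately show ?thesis by simp
  qed
  show "f \<in> S"
    by (rule mpoly_in_subring[OF S const]) (use f x in \<open>unfold gamma_polys_def, blast\<close>)
qed

lemma gamma_polys_subring: "subring_set (gamma_polys n)"
  unfolding subring_set_def
proof (intro conjI ballI)
  show "1 \<in> gamma_polys n" by (auto simp: gamma_polys_def)
  fix f g assume f: "f \<in> gamma_polys n" and g: "g \<in> gamma_polys n"
  have "Poly_Mapping.keys (f - g) \<subseteq> Poly_Mapping.keys f \<union> Poly_Mapping.keys g"
    by (auto simp: in_keys_iff lookup_minus)
  with f g show "f - g \<in> gamma_polys n" by (auto simp: gamma_polys_def)
  show "f * g \<in> gamma_polys n"
    unfolding gamma_polys_def
  proof (intro CollectI ballI)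
    fix m assume "m \<in> Poly_Mapping.keys (f * g)"
    then obtain a b where m: "m = a + b" "a \<in> Poly_Mapping.keys f" "b \<in> Poly_Mapping.keys g"
      using keys_mult[of f g] by auto
    have "Poly_Mapping.keys m \<subseteq> Poly_Mapping.keys a \<union> Poly_Mapping.keys b"
      unfolding m(1) by (rule keys_add)
    also have "\<dots> \<subseteq> {1..n}" using f g m by (auto simp: gamma_polys_def)
    finally show "Poly_Mapping.keys m \<subseteq> {1..n}" .
  qed
qed

lemma PConst_in_gamma_polys: "PConst a \<in> gamma_polys n"
  by (auto simp: gamma_polys_def PConst_def)

lemma X_in_gamma_polys: "i \<in> {1..n} \<Longrightarrow> X i \<in> gamma_polys n"
  by (auto simp: gamma_polys_def PVar_def split: if_splits)


subsection \<open>Generating functions\<close>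

definition fps_alt :: "'b::comm_ring_1 fps \<Rightarrow> 'b fps" where
  "fps_alt f = Abs_fps (\<lambda>k. (-1) ^ k * fps_nth f k)"

definition fps_map :: "('a::comm_ring_1 \<Rightarrow> 'b::comm_ring_1) \<Rightarrow> 'a fps \<Rightarrow> 'b fps" where
  "fps_map h f = Abs_fps (\<lambda>k. h (fps_nth f k))"

definition lin :: "'b::comm_ring_1 \<Rightarrow> 'b fps" where
  "lin a = 1 + fps_const a * fps_X"

definition geo :: "'b::comm_ring_1 \<Rightarrow> 'b fps" where
  "geo a = Abs_fps (\<lambda>k. a ^ k)"

lemma lin_nth: "fps_nth (lin a) k = (if k = 0 then 1 else if k = 1 then a else 0)"
  by (simp add: lin_def)

lemma geo_nth [simp]: "fps_nth (geo a) k = a ^ k"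
  by (simp add: geo_def)

lemma lin_mult_nth:
  "fps_nth (lin a * f) k = (if k = 0 then fps_nth f 0 else fps_nth f k + a * fps_nth f (k - 1))"
  by (simp add: lin_def ring_distribs mult.assoc)

lemma lin_geo [simp]: "lin a * geo (- a) = 1" "lin (- a) * geo a = 1"
proof -
  have *: "lin (- b) * geo b = 1" for b :: 'a
  proof (rule fps_ext)
    fix k
    show "fps_nth (lin (- b) * geo b) k = fps_nth 1 k"
      by (cases k) (simp_all add: lin_mult_nth lin_nth)
  qed
  show "lin a * geo (- a) = 1" using *[of "- a"] by simp
  show "lin (- a) * geo a = 1" by (rule *)
qed

lemma fps_alt_mult: "fps_alt (f * g) = fps_alt f * fps_alt g"
proof (rule fps_ext)
  fix k
  have "(-1) ^ k * (fps_nth f i * fps_nth g (k - i))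
      = ((-1) ^ i * fps_nth f i) * ((-1) ^ (k - i) * fps_nth g (k - i))" if "i \<le> k" for i
  proof -
    have "(-1 :: 'a) ^ k = (-1) ^ i * (-1) ^ (k - i)" using that by (simp flip: power_add)
    then show ?thesis by (simp add: ac_simps)
  qed
  then show "fps_nth (fps_alt (f * g)) k = fps_nth (fps_alt f * fps_alt g) k"
    by (simp add: fps_alt_def fps_mult_nth sum_distrib_left)
qed

lemma fps_alt_1 [simp]: "fps_alt 1 = 1"
  by (rule fps_ext) (simp add: fps_alt_def)

lemma fps_alt_prod: "fps_alt (prod f I) = (\<Prod>i\<in>I. fps_alt (f i))"
  by (induction I rule: infinite_finite_induct) (simp_all add: fps_alt_mult)

lemma fps_alt_lin: "fps_alt (lin a) = lin (- a)"
  by (rule fps_ext) (simp add: fps_alt_def lin_nth)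

lemma fps_alt_geo: "fps_alt (geo a) = geo (- a)"
  by (rule fps_ext) (simp add: fps_alt_def flip: power_mult_distrib)

lemma fps_map_mult: "ring_hom_on UNIV h \<Longrightarrow> fps_map h (f * g) = fps_map h f * fps_map h g"
  by (rule fps_ext) (simp add: fps_map_def fps_mult_nth hom_sum homD)

lemma fps_map_1: "ring_hom_on UNIV h \<Longrightarrow> fps_map h 1 = 1"
  by (rule fps_ext) (simp add: fps_map_def homD)

lemma fps_map_prod: "ring_hom_on UNIV h \<Longrightarrow> fps_map h (prod f I) = (\<Prod>i\<in>I. fps_map h (f i))"
  by (induction I rule: infinite_finite_induct) (simp_all add: fps_map_mult fps_map_1)

lemma fps_map_lin: "ring_hom_on UNIV h \<Longrightarrow> fps_map h (lin a) = lin (h a)"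
  by (rule fps_ext) (simp add: fps_map_def lin_nth homD)

lemma fps_map_geo: "ring_hom_on UNIV h \<Longrightarrow> fps_map h (geo a) = geo (h a)"
  by (rule fps_ext) (simp add: fps_map_def hom_power)

definition fps_in :: "'b::comm_ring_1 set \<Rightarrow> 'b fps set" where
  "fps_in A = {f. \<forall>k. fps_nth f k \<in> A}"

lemma fps_in_mult: "subring_set A \<Longrightarrow> f \<in> fps_in A \<Longrightarrow> g \<in> fps_in A \<Longrightarrow> f * g \<in> fps_in A"
  unfolding fps_in_def
  by (auto simp: fps_mult_nth intro!: subring_set_sum subring_setD(6))

lemma fps_in_1: "subring_set A \<Longrightarrow> 1 \<in> fps_in A"
  by (auto simp: fps_in_def intro: subring_setD)

lemma fps_in_prod: "subring_set A \<Longrightarrow> (\<And>i. i \<in> I \<Longrightarrow> f i \<in> fps_in A) \<Longrightarrow> prod f I \<in> fps_in A"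
  by (induction I rule: infinite_finite_induct) (auto intro: fps_in_mult fps_in_1)

lemma fps_in_lin: "subring_set A \<Longrightarrow> a \<in> A \<Longrightarrow> lin a \<in> fps_in A"
  by (auto simp: fps_in_def lin_nth intro: subring_setD)

lemma fps_in_geo: "subring_set A \<Longrightarrow> a \<in> A \<Longrightarrow> geo a \<in> fps_in A"
  by (auto simp: fps_in_def intro: subring_set_power)

lemma sum_reflect_split:
  fixes f :: "nat \<Rightarrow> 'b::comm_ring_1"
  shows "(\<Sum>j=0..2 * p. f j) = f p + (\<Sum>i=1..p. f (p + i)) + (\<Sum>i=1..p. f (p - i))"
    and "(\<Sum>j=0..2 * p + 1. f j) = (\<Sum>j=0..p. f j) + (\<Sum>j=0..p. f (2 * p + 1 - j))"
proof -
  have a: "(\<Sum>i=1..p. f (p - i)) = (\<Sum>j\<in>{0..<p}. f j)"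
    by (rule sum.reindex_bij_witness[of _ "\<lambda>j. p - j" "\<lambda>j. p - j"]) auto
  have b: "(\<Sum>i=1..p. f (p + i)) = (\<Sum>j\<in>{p+1..2*p}. f j)"
    by (rule sum.reindex_bij_witness[of _ "\<lambda>j. j - p" "\<lambda>j. p + j"]) auto
  have "{0..2 * p} = insert p ({0..<p} \<union> {p+1..2*p})" by auto
  then have "(\<Sum>j=0..2 * p. f j) = f p + (sum f {0..<p} + sum f {p+1..2*p})"
    by (subst sum.union_disjoint[symmetric]) (auto intro: sum.insert)
  then show "(\<Sum>j=0..2 * p. f j) = f p + (\<Sum>i=1..p. f (p + i)) + (\<Sum>i=1..p. f (p - i))"
    unfolding a b by (simp only: ac_simps)
  have c: "(\<Sum>j=0..p. f (2 * p + 1 - j)) = (\<Sum>j\<in>{p+1..2*p+1}. f j)"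
    by (rule sum.reindex_bij_witness[of _ "\<lambda>j. 2*p+1 - j" "\<lambda>j. 2*p+1 - j"]) auto
  have "{0..2 * p + 1} = {0..p} \<union> {p+1..2*p+1}" by auto
  then have "(\<Sum>j=0..2 * p + 1. f j) = sum f {0..p} + sum f {p+1..2*p+1}"
    by (subst sum.union_disjoint[symmetric]) auto
  then show "(\<Sum>j=0..2 * p + 1. f j) = (\<Sum>j=0..p. f j) + (\<Sum>j=0..p. f (2 * p + 1 - j))"
    by (simp only: c)
qed

lemma fps_mult_alt_even:
  fixes d :: "nat \<Rightarrow> 'b::comm_ring_1"
  shows "fps_nth (Abs_fps d * fps_alt (Abs_fps d)) (2 * p) =
    (-1) ^ p * (d p ^ 2 + 2 * (\<Sum>i=1..p. (-1) ^ i * d (p + i) * d (p - i)))"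
proof -
  let ?f = "\<lambda>j. d j * ((-1) ^ (2 * p - j) * d (2 * p - j))"
  have e: "?f (p + i) = (-1) ^ p * ((-1) ^ i * d (p + i) * d (p - i))"
    "?f (p - i) = (-1) ^ p * ((-1) ^ i * d (p + i) * d (p - i))" if "i \<in> {1..p}" for i
  proof -
    have *: "2 * p - (p + i) = p - i" "2 * p - (p - i) = p + i" using that by auto
    have "(-1 :: 'b) ^ p * (-1) ^ i = (-1) ^ (p - i + 2 * i)"
    proof -
      have "p + i = p - i + 2 * i" using that by simp
      then show ?thesis by (simp only: power_add[symmetric])
    qed
    also have "\<dots> = (-1) ^ (p - i)" by (simp add: power_add power_mult)
    finally show "?f (p + i) = (-1) ^ p * ((-1) ^ i * d (p + i) * d (p - i))"
      unfolding * by (simp add: ac_simps) (simp add: mult.assoc[symmetric])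
    show "?f (p - i) = (-1) ^ p * ((-1) ^ i * d (p + i) * d (p - i))"
      unfolding * by (simp add: power_add ac_simps)
  qed
  have "fps_nth (Abs_fps d * fps_alt (Abs_fps d)) (2 * p) = (\<Sum>j=0..2 * p. ?f j)"
    by (simp add: fps_mult_nth fps_alt_def)
  also have "\<dots> = (-1) ^ p * (d p ^ 2 + 2 * (\<Sum>i=1..p. (-1) ^ i * d (p + i) * d (p - i)))"
  proof -
    let ?t = "(-1) ^ p * (\<Sum>i=1..p. (-1) ^ i * d (p + i) * d (p - i))"
    have "(\<Sum>i=1..p. ?f (p + i)) = ?t" "(\<Sum>i=1..p. ?f (p - i)) = ?t"
      unfolding sum_distrib_left by (intro sum.cong refl e; assumption)+
    moreover have "?f p = (-1) ^ p * d p ^ 2" by (simp add: power2_eq_square)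
    ultimately show ?thesis unfolding sum_reflect_split by (simp add: ring_distribs)
  qed
  finally show ?thesis .
qed

lemma fps_mult_alt_odd:
  fixes d :: "nat \<Rightarrow> 'b::comm_ring_1"
  shows "fps_nth (Abs_fps d * fps_alt (Abs_fps d)) (2 * p + 1) = 0"
proof -
  let ?f = "\<lambda>j. d j * ((-1) ^ (2 * p + 1 - j) * d (2 * p + 1 - j))"
  have e: "?f (2 * p + 1 - j) = - ?f j" if "j \<in> {0..p}" for j
  proof -
    have *: "2 * p + 1 - (2 * p + 1 - j) = j" using that by auto
    have "(-1 :: 'b) ^ (2 * p + 1 - j) * (-1) ^ j = (-1) ^ (2 * p + 1)"
      using that by (simp flip: power_add)
    then have "(-1 :: 'b) ^ (2 * p + 1 - j) * (-1) ^ j * (-1) ^ j = - ((-1) ^ j)"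
      by simp
    then have "(-1 :: 'b) ^ (2 * p + 1 - j) = - ((-1) ^ j)"
      by (simp add: mult.assoc flip: power_mult_distrib)
    then show ?thesis unfolding * by (simp add: ac_simps)
  qed
  have "fps_nth (Abs_fps d * fps_alt (Abs_fps d)) (2 * p + 1) = (\<Sum>j=0..2 * p + 1. ?f j)"
    by (simp add: fps_mult_nth fps_alt_def del: One_nat_def)
  also have "\<dots> = 0"
    unfolding sum_reflect_split using e by (simp add: sum_negf del: One_nat_def)
  finally show ?thesis .
qed

lemma gamma_seq_iff:
  "gamma_seq d \<longleftrightarrow> d 0 = 1 \<and> Abs_fps d * fps_alt (Abs_fps d) = 1"
proof (intro iffI conjI)
  assume d: "gamma_seq d"
  then show "d 0 = 1" by (simp add: gamma_seq_def)
  show "Abs_fps d * fps_alt (Abs_fps d) = 1"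
  proof (rule fps_ext)
    fix k
    show "fps_nth (Abs_fps d * fps_alt (Abs_fps d)) k = fps_nth 1 k"
    proof (cases "even k")
      case True
      then obtain p where k: "k = 2 * p" by auto
      show ?thesis
        unfolding k fps_mult_alt_even using d by (cases "p = 0") (auto simp: gamma_seq_def)
    next
      case False
      then obtain p where k: "k = 2 * p + 1" by (elim oddE)
      show ?thesis
        unfolding k fps_mult_alt_odd by simp
    qed
  qed
next
  assume d: "d 0 = 1 \<and> Abs_fps d * fps_alt (Abs_fps d) = 1"
  show "gamma_seq d"
    unfolding gamma_seq_def
  proof (intro conjI allI impI)
    show "d 0 = 1" using d by simp
    fix p :: nat assume p: "1 \<le> p"
    let ?s = "d p ^ 2 + 2 * (\<Sum>i=1..p. (-1) ^ i * d (p + i) * d (p - i))"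
    have "(-1) ^ p * ?s = fps_nth 1 (2 * p)"
      using d fps_mult_alt_even[of d p] by simp
    then have "(-1) ^ p * ((-1) ^ p * ?s) = 0" using p by simp
    then show "?s = 0" by (simp add: mult.assoc[symmetric] flip: power_mult_distrib)
  qed
qed


subsection \<open>Signed permutations\<close>

lemma signed_perms_0 [simp]: "w \<in> signed_perms n \<Longrightarrow> w 0 = 0"
  by (auto simp: signed_perms_def dest: spec[of _ 0])

lemma signed_perms_neg: "w \<in> signed_perms n \<Longrightarrow> w (- i) = - w i"
  by (auto simp: signed_perms_def)

lemma signed_perms_inj: "w \<in> signed_perms n \<Longrightarrow> w i = w j \<longleftrightarrow> i = j"
  by (auto simp: signed_perms_def dest: permutes_inj injD)

lemma signed_perms_eq_0 [simp]: "w \<in> signed_perms n \<Longrightarrow> w i = 0 \<longleftrightarrow> i = 0"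
  using signed_perms_inj[of w n i 0] by simp

lemma signed_perms_in: "w \<in> signed_perms n \<Longrightarrow> i \<in> {- int n..int n} \<Longrightarrow> w i \<in> {- int n..int n}"
  by (simp only: signed_perms_def mem_Collect_eq permutes_in_image)

lemma id_in_signed_perms [simp]: "id \<in> signed_perms n"
  by (simp add: signed_perms_def permutes_id)

lemma comp_in_signed_perms:
  "v \<in> signed_perms n \<Longrightarrow> w \<in> signed_perms n \<Longrightarrow> v \<circ> w \<in> signed_perms n"
  by (auto simp: signed_perms_def intro: permutes_compose)

lemma inv_in_signed_perms:
  assumes "w \<in> signed_perms n"
  shows "inv w \<in> signed_perms n" "w \<circ> inv w = id" "inv w \<circ> w = id"
proof -
  have w: "w permutes {- int n..int n}" using assms by (simp add: signed_perms_def)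
  show "w \<circ> inv w = id" "inv w \<circ> w = id" using permutes_inv_o[OF w] by auto
  have "inv w (- i) = - inv w i" for i
  proof -
    have "w (- inv w i) = - i"
      using signed_perms_neg[OF assms] permutes_inverses(1)[OF w] by simp
    then show ?thesis using permutes_inverses(2)[OF w] by metis
  qed
  then show "inv w \<in> signed_perms n" using permutes_inv[OF w] by (simp add: signed_perms_def)
qed

lemma signed_perms_bij_abs:
  assumes w: "w \<in> signed_perms n"
  shows "bij_betw (\<lambda>i. nat \<bar>w (int i)\<bar>) {1..n} {1..n}"
proof -
  have inj: "inj_on (\<lambda>i. nat \<bar>w (int i)\<bar>) {1..n}"
  proof (rule inj_onI)
    fix i j assume ij: "i \<in> {1..n}" "j \<in> {1..n}" "nat \<bar>w (int i)\<bar> = nat \<bar>w (int j)\<bar>"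
    then have "w (int i) = w (int j) \<or> w (int i) = w (- int j)"
      by (auto simp: signed_perms_neg[OF w] abs_eq_iff)
    with ij show "i = j" by (auto simp: signed_perms_inj[OF w])
  qed
  have "(\<lambda>i. nat \<bar>w (int i)\<bar>) ` {1..n} \<subseteq> {1..n}"
  proof (intro image_subsetI)
    fix i assume i: "i \<in> {1..n}"
    then have "w (int i) \<in> {- int n..int n}" by (intro signed_perms_in[OF w]) auto
    moreover have "w (int i) \<noteq> 0" using w i by simp
    ultimately show "nat \<bar>w (int i)\<bar> \<in> {1..n}" by auto
  qed
  with inj show ?thesis by (simp add: bij_betw_def endo_inj_surj)
qed

lemma simple_refl_in_signed_perms:
  assumes "i < n"
  shows "simple_refl i \<in> signed_perms n"
proof (cases "i = 0")
  case True
  then show ?thesis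
    using assms
    by (auto simp: simple_refl_def signed_perms_def transpose_def intro!: permutes_swap_id)
next
  case False
  have "simple_refl i permutes {- int n..int n}"
    using assms False by (auto simp: simple_refl_def intro!: permutes_compose permutes_swap_id)
  moreover have "simple_refl i (- j) = - simple_refl i j" for j
    using False by (auto simp: simple_refl_def transpose_def)
  ultimately show ?thesis by (simp add: signed_perms_def)
qed

lemma simple_refl_involution: "simple_refl i (simple_refl i j) = j"
  by (auto simp: simple_refl_def transpose_def)

inductive_set refl_products :: "nat \<Rightarrow> (int \<Rightarrow> int) set" for n where
  "id \<in> refl_products n"
| "i < n \<Longrightarrow> w \<in> refl_products n \<Longrightarrow> simple_refl i \<circ> w \<in> refl_products n"

lemma signed_perms_subset_refl_products:
  assumes "w \<in> signed_perms m" "m \<le> n"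
  shows "w \<in> refl_products n"
  using assms
proof (induction m arbitrary: w)
  case 0
  then have "w permutes {0}" by (simp add: signed_perms_def)
  then have "w = id" by simp
  then show ?case using refl_products.intros(1) by metis
next
  case (Suc m)
  let ?m = "int (Suc m)"
  show ?case
    using Suc.prems
  proof (induction "nat (?m - w ?m)" arbitrary: w rule: less_induct)
    case less
    note w = less.prems(1)
    have r: "w ?m \<in> {- ?m..?m}" by (rule signed_perms_in[OF w]) auto
    have nz: "w ?m \<noteq> 0" using w by simp
    show ?case
    proof (cases "w ?m = ?m")
      case True
      have "w permutes {- int m..int m}"
      proof (rule permutes_superset)
        show "w permutes {- ?m..?m}" using w by (simp add: signed_perms_def)
        fix x assume "x \<in> {- ?m..?m} - {- int m..int m}"
        then have "x = ?m \<or> x = - ?m" by auto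
        then show "w x = x" using True signed_perms_neg[OF w, of ?m] by auto
      qed
      then have "w \<in> signed_perms m" using w by (simp add: signed_perms_def)
      then show ?thesis using Suc.IH Suc.prems(2) by simp
    next
      case False
      define i where
        "i = (if w ?m > 0 then nat (w ?m) else nat (- w ?m - 1))"
      have i: "i < Suc m" using False r nz by (auto simp: i_def)
      have up: "simple_refl i (w ?m) > w ?m"
        using nz by (auto simp: i_def simple_refl_def transpose_def)
      let ?v = "simple_refl i \<circ> w"
      have v: "?v \<in> signed_perms (Suc m)"
        by (intro comp_in_signed_perms simple_refl_in_signed_perms i w)
      have "nat (?m - ?v ?m) < nat (?m - w ?m)" using up r False by auto
      then have vr: "?v \<in> refl_products n" using less.hyps v less.prems(2) by blast
      have "i < n" using i less.prems(2) by simp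
      from refl_products.intros(2)[OF this vr] have "simple_refl i \<circ> ?v \<in> refl_products n" .
      moreover have "simple_refl i \<circ> ?v = w"
        by (rule ext) (simp add: simple_refl_involution)
      ultimately show ?thesis by (simp only:)
    qed
  qed
qed

lemma signed_perms_eq_refl_products: "signed_perms n = refl_products n"
proof
  show "signed_perms n \<subseteq> refl_products n" using signed_perms_subset_refl_products by blast
  show "refl_products n \<subseteq> signed_perms n"
  proof
    fix w assume "w \<in> refl_products n"
    then show "w \<in> signed_perms n"
      by induction (blast intro: id_in_signed_perms comp_in_signed_perms simple_refl_in_signed_perms)+
  qed
qed


subsection \<open>Construction of the action\<close>

definition signed_X :: "int \<Rightarrow> gamma mpoly" where
  "signed_X k = (if k \<ge> 0 then X (nat k) else - X (nat (- k)))"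

definition C_fps :: "gamma mpoly fps" where
  "C_fps = Abs_fps C"

definition weyl_factor :: "nat \<Rightarrow> (int \<Rightarrow> int) \<Rightarrow> gamma mpoly fps" where
  "weyl_factor n w = (\<Prod>i=1..n. lin (X i) * geo (- signed_X (w (int i))))"

definition weyl_C :: "nat \<Rightarrow> (int \<Rightarrow> int) \<Rightarrow> nat \<Rightarrow> gamma mpoly" where
  "weyl_C n w p = fps_nth (C_fps * weyl_factor n w) p"

definition weyl_map :: "nat \<Rightarrow> (int \<Rightarrow> int) \<Rightarrow> gamma mpoly \<Rightarrow> gamma mpoly" where
  "weyl_map n w = poly_eval (gamma_eval (weyl_C n w)) (\<lambda>i. signed_X (w (int i)))"

lemma C_fps_alt: "C_fps * fps_alt C_fps = 1"
proof -
  have "C p ^ 2 + 2 * (\<Sum>i=1..p. (-1) ^ i * C (p + i) * C (p - i)) = 0" if "p \<ge> 1" for p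
  proof -
    have "C p ^ 2 + 2 * (\<Sum>i=1..p. (-1) ^ i * C (p + i) * C (p - i)) =
        PConst (gamma_c p ^ 2 + 2 * (\<Sum>i=1..p. (-1) ^ i * gamma_c (p + i) * gamma_c (p - i)))"
      by (simp add: homD[OF PConst_hom] hom_sum[OF PConst_hom] hom_power[OF PConst_hom]
          hom_two[OF PConst_hom])
    then show ?thesis
      unfolding gamma_seqD(2)[OF gamma_seq_gamma_c that] by (simp add: homD[OF PConst_hom])
  qed
  then have "gamma_seq C" unfolding gamma_seq_def by simp
  then show ?thesis by (simp add: gamma_seq_iff C_fps_def)
qed

lemma signed_X_abs: "signed_X k = X (nat \<bar>k\<bar>) \<or> signed_X k = - X (nat \<bar>k\<bar>)"
  by (auto simp: signed_X_def)

lemma signed_X_uminus: "k \<noteq> 0 \<Longrightarrow> signed_X (- k) = - signed_X k"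
  by (auto simp: signed_X_def)

lemma signed_X_int [simp]: "signed_X (int i) = X i"
  by (simp add: signed_X_def)

lemma weyl_factor_alt:
  assumes w: "w \<in> signed_perms n"
  shows "weyl_factor n w * fps_alt (weyl_factor n w) = 1"
proof -
  let ?N = "\<lambda>a :: gamma mpoly. geo a * geo (- a)"
  have N: "?N (signed_X (w (int i))) = ?N (X (nat \<bar>w (int i)\<bar>))" for i
    using signed_X_abs[of "w (int i)"] by (auto simp: mult.commute)
  have "weyl_factor n w * fps_alt (weyl_factor n w)
      = (\<Prod>i=1..n. (lin (X i) * lin (- X i)) * ?N (signed_X (w (int i))))"
    unfolding weyl_factor_def fps_alt_prod fps_alt_mult fps_alt_lin fps_alt_geo
    by (simp add: prod.distrib ac_simps)
  also have "\<dots> = (\<Prod>i=1..n. lin (X i) * lin (- X i)) * (\<Prod>i=1..n. ?N (X (nat \<bar>w (int i)\<bar>)))"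
    unfolding N by (rule prod.distrib)
  also have "(\<Prod>i=1..n. ?N (X (nat \<bar>w (int i)\<bar>))) = (\<Prod>i=1..n. ?N (X i))"
    by (rule prod.reindex_bij_betw[OF signed_perms_bij_abs[OF w]])
  also have "(\<Prod>i=1..n. lin (X i) * lin (- X i)) * \<dots>
      = (\<Prod>i=1..n. (lin (X i) * geo (- X i)) * (lin (- X i) * geo (X i)))"
    by (simp only: prod.distrib ac_simps)
  also have "\<dots> = 1" by simp
  finally show ?thesis .
qed

lemma weyl_factor_0: "fps_nth (weyl_factor n w) 0 = 1"
proof -
  have "fps_nth (prod f I) 0 = 1" if "\<And>i. fps_nth (f i) 0 = 1"
    for f :: "nat \<Rightarrow> gamma mpoly fps" and I
    by (induction I rule: infinite_finite_induct) (simp_all add: that)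
  then show ?thesis by (simp add: weyl_factor_def lin_nth)
qed

lemma weyl_C_gamma_seq:
  assumes w: "w \<in> signed_perms n"
  shows "gamma_seq (weyl_C n w)"
proof -
  have eq: "Abs_fps (weyl_C n w) = C_fps * weyl_factor n w"
    by (rule fps_ext) (simp add: weyl_C_def)
  have "(C_fps * weyl_factor n w) * fps_alt (C_fps * weyl_factor n w)
      = (C_fps * fps_alt C_fps) * (weyl_factor n w * fps_alt (weyl_factor n w))"
    by (simp only: fps_alt_mult ac_simps)
  also have "\<dots> = 1" by (simp add: C_fps_alt weyl_factor_alt[OF w])
  finally have "Abs_fps (weyl_C n w) * fps_alt (Abs_fps (weyl_C n w)) = 1" by (simp add: eq)
  moreover have "weyl_C n w 0 = 1" by (simp add: weyl_C_def C_fps_def weyl_factor_0)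
  ultimately show ?thesis by (simp add: gamma_seq_iff)
qed

context
  fixes n :: nat and w :: "int \<Rightarrow> int"
  assumes w: "w \<in> signed_perms n"
begin

lemma weyl_map_hom: "ring_hom_on UNIV (weyl_map n w)"
  unfolding weyl_map_def by (intro poly_eval_hom gamma_eval_hom weyl_C_gamma_seq w)

lemma weyl_map_X: "weyl_map n w (X i) = signed_X (w (int i))"
  unfolding weyl_map_def by (intro poly_eval_PVar gamma_eval_hom weyl_C_gamma_seq w)

lemma weyl_map_C: "weyl_map n w (C p) = weyl_C n w p"
  unfolding weyl_map_def
  by (simp add: poly_eval_PConst gamma_eval_hom gamma_eval_gamma_c weyl_C_gamma_seq[OF w])

lemma weyl_map_signed_X: "weyl_map n w (signed_X k) = signed_X (w k)"
proof (cases "k \<ge> 0")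
  case True
  then show ?thesis by (simp add: signed_X_def[of k] weyl_map_X)
next
  case False
  then have "weyl_map n w (signed_X k) = - signed_X (w (- k))"
    by (simp add: signed_X_def[of k] weyl_map_X homD[OF weyl_map_hom])
  also have "\<dots> = signed_X (w k)"
    using False w by (simp add: signed_perms_neg[OF w] signed_X_uminus)
  finally show ?thesis .
qed

lemma signed_X_in: "i \<in> {1..n} \<Longrightarrow> signed_X (w (int i)) \<in> gamma_polys n"
  using bij_betwE[OF signed_perms_bij_abs[OF w]] signed_X_abs[of "w (int i)"]
    X_in_gamma_polys[of "nat \<bar>w (int i)\<bar>" n] subring_setD(4)[OF gamma_polys_subring]
  by metis

lemma weyl_map_in: "f \<in> gamma_polys n \<Longrightarrow> weyl_map n w f \<in> gamma_polys n"
proof -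
  note R = gamma_polys_subring[of n]
  have "C_fps * weyl_factor n w \<in> fps_in (gamma_polys n)"
    unfolding weyl_factor_def
    by (intro fps_in_mult[OF R] fps_in_prod[OF R] fps_in_lin[OF R] fps_in_geo[OF R]
        subring_setD(4)[OF R] X_in_gamma_polys signed_X_in)
      (auto simp: fps_in_def C_fps_def PConst_in_gamma_polys)
  then have "weyl_C n w p \<in> gamma_polys n" for p by (simp add: weyl_C_def fps_in_def)
  then have "gamma_polys n \<subseteq> {f. weyl_map n w f \<in> gamma_polys n}"
    by (intro gamma_polys_subset hom_vimage_subring[OF weyl_map_hom R])
      (auto simp: weyl_map_C weyl_map_X signed_X_in)
  then show "f \<in> gamma_polys n \<Longrightarrow> weyl_map n w f \<in> gamma_polys n" by blast
qed

end

lemma weyl_C_comp: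
  assumes v: "v \<in> signed_perms n" and w: "w \<in> signed_perms n"
  shows "weyl_map n v (weyl_C n w p) = weyl_C n (v \<circ> w) p"
proof -
  note h = weyl_map_hom[OF v]
  have C: "fps_map (weyl_map n v) C_fps = C_fps * weyl_factor n v"
    by (rule fps_ext) (simp add: fps_map_def C_fps_def weyl_map_C[OF v] weyl_C_def)
  have F: "fps_map (weyl_map n v) (weyl_factor n w) =
      (\<Prod>i=1..n. lin (signed_X (v (int i))) * geo (- signed_X (v (w (int i)))))"
    by (simp add: weyl_factor_def fps_map_prod[OF h] fps_map_mult[OF h] fps_map_lin[OF h]
        fps_map_geo[OF h] homD[OF h] weyl_map_X[OF v] weyl_map_signed_X[OF v])
  have "weyl_factor n v * fps_map (weyl_map n v) (weyl_factor n w) =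
      (\<Prod>i=1..n. (lin (X i) * geo (- signed_X (v (w (int i)))))
        * (lin (signed_X (v (int i))) * geo (- signed_X (v (int i)))))"
    by (subst F, unfold weyl_factor_def prod.distrib[symmetric]) (simp only: ac_simps)
  also have "\<dots> = weyl_factor n (v \<circ> w)" by (simp add: weyl_factor_def)
  finally have "fps_map (weyl_map n v) (C_fps * weyl_factor n w) = C_fps * weyl_factor n (v \<circ> w)"
    by (simp add: fps_map_mult[OF h] C mult.assoc)
  then have "fps_nth (fps_map (weyl_map n v) (C_fps * weyl_factor n w)) p
      = fps_nth (C_fps * weyl_factor n (v \<circ> w)) p" by simp
  then show ?thesis by (simp add: weyl_C_def fps_map_def)
qed

lemma gamma_polys_hom_eqI:
  assumes f: "ring_hom_on (gamma_polys n) f" and g: "ring_hom_on (gamma_polys n) g"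
    and c: "\<And>p. p \<ge> 1 \<Longrightarrow> f (C p) = g (C p)" and x: "\<And>i. i \<in> {1..n} \<Longrightarrow> f (X i) = g (X i)"
    and a: "a \<in> gamma_polys n"
  shows "f a = g a"
proof -
  have "gamma_polys n \<subseteq> {a \<in> gamma_polys n. f a = g a}"
    by (intro gamma_polys_subset hom_equalizer_subring[OF f g gamma_polys_subring])
      (auto simp: c x PConst_in_gamma_polys X_in_gamma_polys)
  with a show ?thesis by auto
qed

lemma ring_hom_on_subset: "ring_hom_on B h \<Longrightarrow> A \<subseteq> B \<Longrightarrow> ring_hom_on A h"
  by (auto simp: ring_hom_on_def)

lemma weyl_map_comp:
  assumes v: "v \<in> signed_perms n" and w: "w \<in> signed_perms n" and a: "a \<in> gamma_polys n"
  shows "weyl_map n (v \<circ> w) a = weyl_map n v (weyl_map n w a)"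
proof (rule gamma_polys_hom_eqI[OF _ _ _ _ a])
  note vw = comp_in_signed_perms[OF v w]
  show "ring_hom_on (gamma_polys n) (weyl_map n (v \<circ> w))"
    by (rule ring_hom_on_subset[OF weyl_map_hom[OF vw]]) simp
  show "ring_hom_on (gamma_polys n) (\<lambda>a. weyl_map n v (weyl_map n w a))"
    by (simp add: ring_hom_on_def homD[OF weyl_map_hom[OF v]] homD[OF weyl_map_hom[OF w]])
  show "weyl_map n (v \<circ> w) (C p) = weyl_map n v (weyl_map n w (C p))" for p
    by (simp only: weyl_map_C[OF vw] weyl_map_C[OF w] weyl_C_comp[OF v w])
  show "weyl_map n (v \<circ> w) (X i) = weyl_map n v (weyl_map n w (X i))" for i
    by (simp add: weyl_map_X[OF vw] weyl_map_X[OF w] weyl_map_signed_X[OF v])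
qed

lemma weyl_C_pos:
  assumes w: "w \<in> signed_perms n" and pos: "\<And>i. i \<in> {1..n} \<Longrightarrow> w (int i) > 0"
  shows "weyl_C n w p = C p"
proof -
  have "weyl_factor n w = (\<Prod>i=1..n. lin (X i) * geo (- X (nat \<bar>w (int i)\<bar>)))"
    unfolding weyl_factor_def
    by (rule prod.cong) (use pos in \<open>auto simp: signed_X_def less_imp_le\<close>)
  also have "\<dots> = (\<Prod>i=1..n. lin (X i)) * (\<Prod>i=1..n. geo (- X (nat \<bar>w (int i)\<bar>)))"
    by (rule prod.distrib)
  also have "(\<Prod>i=1..n. geo (- X (nat \<bar>w (int i)\<bar>))) = (\<Prod>i=1..n. geo (- X i))"
    by (rule prod.reindex_bij_betw[OF signed_perms_bij_abs[OF w]])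
  also have "(\<Prod>i=1..n. lin (X i)) * \<dots> = 1"
    unfolding prod.distrib[symmetric] by simp
  finally show ?thesis by (simp add: weyl_C_def C_fps_def)
qed

lemma weyl_map_id: "a \<in> gamma_polys n \<Longrightarrow> weyl_map n id a = a"
proof (rule gamma_polys_hom_eqI[of n _ "\<lambda>a. a"])
  show "ring_hom_on (gamma_polys n) (weyl_map n id)"
    by (rule ring_hom_on_subset[OF weyl_map_hom]) simp_all
  show "ring_hom_on (gamma_polys n) (\<lambda>a. a)" by (simp add: ring_hom_on_def)
  show "weyl_map n id (C p) = C p" for p
    unfolding weyl_map_C[OF id_in_signed_perms]
    by (rule weyl_C_pos[OF id_in_signed_perms]) simp
  show "weyl_map n id (X i) = X i" for i
    by (simp add: weyl_map_X)
qed

lemma weyl_C_simple_refl_0: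
  assumes n: "n \<ge> 1" and p: "p \<ge> 1"
  shows "weyl_C n (simple_refl 0) p = C p + 2 * (\<Sum>j=1..p. X 1 ^ j * C (p - j))"
proof -
  let ?G = "lin (X 1) * geo (X 1)"
  have "{1..n} = insert 1 {2..n}" using n by auto
  then have "weyl_factor n (simple_refl 0) =
      (lin (X 1) * geo (- signed_X (simple_refl 0 (int 1)))) *
      (\<Prod>i=2..n. lin (X i) * geo (- signed_X (simple_refl 0 (int i))))"
    unfolding weyl_factor_def by simp
  also have "(\<Prod>i=2..n. lin (X i) * geo (- signed_X (simple_refl 0 (int i)))) = 1"
  proof (rule prod.neutral, rule ballI)
    fix i assume "i \<in> {2..n}"
    then have "simple_refl 0 (int i) = int i" by (simp add: simple_refl_def transpose_def)
    then show "lin (X i) * geo (- signed_X (simple_refl 0 (int i))) = 1" by simp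
  qed
  also have "signed_X (simple_refl 0 (int 1)) = - X 1"
    by (simp add: simple_refl_def signed_X_def)
  finally have F: "weyl_factor n (simple_refl 0) = ?G" by simp
  have G: "fps_nth ?G j = (if j = 0 then 1 else 2 * X 1 ^ j)" for j
    by (cases j) (simp_all add: lin_mult_nth lin_nth)
  have "weyl_C n (simple_refl 0) p = fps_nth (?G * C_fps) p"
    by (simp add: weyl_C_def F mult.commute)
  also have "\<dots> = (\<Sum>j=0..p. fps_nth ?G j * C (p - j))"
    unfolding fps_mult_nth[of ?G C_fps] by (simp only: C_fps_def fps_nth_Abs_fps)
  also have "\<dots> = C p + (\<Sum>j=1..p. fps_nth ?G j * C (p - j))"
    by (simp add: sum.atLeast_Suc_atMost G lin_nth)
  also have "(\<Sum>j=1..p. fps_nth ?G j * C (p - j)) = 2 * (\<Sum>j=1..p. X 1 ^ j * C (p - j))"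
    unfolding sum_distrib_left G by (intro sum.cong) (auto simp: mult.assoc)
  finally show ?thesis .
qed

theorem is_weyl_action_weyl_map:
  assumes n: "n \<ge> 1"
  shows "is_weyl_action n (weyl_map n)"
  unfolding is_weyl_action_def
proof (intro conjI ballI allI impI)
  fix w assume w: "w \<in> signed_perms n"
  note iw = inv_in_signed_perms[OF w]
  have "bij_betw (weyl_map n w) (gamma_polys n) (gamma_polys n)"
    by (rule bij_betw_byWitness[where f' = "weyl_map n (inv w)"])
      (auto simp: weyl_map_in w iw weyl_map_id simp flip: weyl_map_comp)
  then show "ring_automorphism_on (gamma_polys n) (weyl_map n w)"
    using ring_hom_on_subset[OF weyl_map_hom[OF w]] by (simp add: ring_automorphism_on_def)
next
  fix i assume i: "i \<in> {1..<n}"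
  then have s: "simple_refl i \<in> signed_perms n" by (intro simple_refl_in_signed_perms) auto
  show "weyl_map n (simple_refl i) (X i) = X (i + 1)"
    "weyl_map n (simple_refl i) (X (i + 1)) = X i"
    unfolding weyl_map_X[OF s] using i
    by (auto simp: simple_refl_def transpose_def signed_X_def nat_add_distrib)
  show "weyl_map n (simple_refl i) (X j) = X j" if "j \<in> {1..n} - {i, i + 1}" for j
    unfolding weyl_map_X[OF s] using i that by (auto simp: simple_refl_def transpose_def)
  show "weyl_map n (simple_refl i) (C p) = C p" for p
    unfolding weyl_map_C[OF s]
    by (rule weyl_C_pos[OF s]) (use i in \<open>auto simp: simple_refl_def transpose_def\<close>)
next
  have s: "simple_refl 0 \<in> signed_perms n" using n by (intro simple_refl_in_signed_perms) auto
  show "weyl_map n (simple_refl 0) (X 1) = - X 1"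
    unfolding weyl_map_X[OF s] by (simp add: simple_refl_def signed_X_def)
  show "weyl_map n (simple_refl 0) (X j) = X j" if "j \<in> {2..n}" for j
    unfolding weyl_map_X[OF s] using that by (auto simp: simple_refl_def transpose_def)
  show "weyl_map n (simple_refl 0) (C p) = C p + 2 * (\<Sum>j=1..p. X 1 ^ j * C (p - j))"
    if "1 \<le> p" for p
    using weyl_C_simple_refl_0[OF n that] by (simp add: weyl_map_C[OF s])
qed (simp_all add: weyl_map_id weyl_map_comp)

theorem is_weyl_action_weyl_action:
  assumes "n \<ge> 1"
  shows "is_weyl_action n (weyl_action n)"
  unfolding weyl_action_def by (rule someI[where P = "is_weyl_action n", OF is_weyl_action_weyl_map[OF assms]])

lemma is_weyl_action_unique:
  assumes f: "is_weyl_action n \<phi>" and g: "is_weyl_action n \<psi>" and n: "n \<ge> 1"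
    and w: "w \<in> signed_perms n" and a: "a \<in> gamma_polys n"
  shows "\<phi> w a = \<psi> w a"
proof -
  have hom: "ring_hom_on (gamma_polys n) (\<chi> v)" "\<And>b. b \<in> gamma_polys n \<Longrightarrow> \<chi> v b \<in> gamma_polys n"
    if "is_weyl_action n \<chi>" "v \<in> signed_perms n" for \<chi> v
    using that by (auto simp: is_weyl_action_def ring_automorphism_on_def dest: bij_betwE)
  have refl: "\<phi> (simple_refl i) b = \<psi> (simple_refl i) b" if i: "i < n" and b: "b \<in> gamma_polys n" for i b
  proof (rule gamma_polys_hom_eqI[OF hom(1)[OF f] hom(1)[OF g] _ _ b])
    show "simple_refl i \<in> signed_perms n" "simple_refl i \<in> signed_perms n"
      by (intro simple_refl_in_signed_perms i)+
    show "\<phi> (simple_refl i) (C p) = \<psi> (simple_refl i) (C p)" if "p \<ge> 1" for p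
      using f g i that by (cases "i = 0") (auto simp: is_weyl_action_def)
    show "\<phi> (simple_refl i) (X j) = \<psi> (simple_refl i) (X j)" if j: "j \<in> {1..n}" for j
    proof (cases "i = 0")
      case True
      show ?thesis
      proof (cases "j = 1")
        case False
        then have "j \<in> {2..n}" using j by auto
        with f g True show ?thesis by (simp add: is_weyl_action_def)
      qed (use f g True in \<open>simp add: is_weyl_action_def\<close>)
    next
      case False
      then have "i \<in> {1..<n}" using i by auto
      with f g j show ?thesis
        by (cases "j = i"; cases "j = i + 1") (simp_all add: is_weyl_action_def)
    qed
  qed
  have "w \<in> refl_products n" using w by (simp add: signed_perms_eq_refl_products)
  then show ?thesis
  proof induction
    case 1
    have "\<phi> id a = \<psi> id a"
      using f g a unfolding is_weyl_action_def by metis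
    then show ?case by (simp only: id_def)
  next
    case (2 i v)
    then have v: "v \<in> signed_perms n" by (simp add: signed_perms_eq_refl_products)
    have s: "simple_refl i \<in> signed_perms n" using 2 by (intro simple_refl_in_signed_perms)
    have "\<phi> (simple_refl i \<circ> v) a = \<phi> (simple_refl i) (\<phi> v a)"
      using f s v a by (simp add: is_weyl_action_def)
    also have "\<dots> = \<psi> (simple_refl i) (\<psi> v a)"
      using refl[OF 2(1)] hom(2)[OF g v a] 2 by simp
    also have "\<dots> = \<psi> (simple_refl i \<circ> v) a"
      using g s v a by (simp add: is_weyl_action_def)
    finally show ?case by (simp only: comp_def)
  qed
qed

theorem weyl_action_unique:
  assumes "n \<ge> 1" "is_weyl_action n \<phi>" "w \<in> signed_perms n" "a \<in> gamma_polys n"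
  shows "weyl_action n w a = \<phi> w a"
  using is_weyl_action_unique[OF is_weyl_action_weyl_action] assms by blast

end

theory Submission
  imports Defs "HOL-Computational_Algebra.Polynomial"
begin

text \<open>
  The symmetry is exhausted one variable at a time. Let \<open>W\<^sub>k\<close> be the signed permutations of
  \<open>1, \<dots>, k\<close>, and let \<open>R\<^sub>k\<close> be the subring generated by the theta polynomials of level \<open>k\<close> and by the
  remaining variables \<open>x\<^sub>k\<^sub>+\<^sub>1, \<dots>, x\<^sub>n\<close> (\<open>partial_theta n k\<close> below). Then \<open>R\<^sub>0\<close> is the whole ring
  \<open>\<Gamma>[X\<^sub>n]\<close> and \<open>R\<^sub>n\<close> is the ring of theta polynomials, and induction on \<open>k\<close> shows that every
  \<open>W\<^sub>k\<close>-invariant lies in \<open>R\<^sub>k\<close>; conversely \<open>W\<^sub>k\<close> fixes \<open>R\<^sub>k\<close> because it fixes the generating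
  function \<open>\<Theta>\<^sub>k(t) = C(t) (1 + x\<^sub>1 t) \<cdots> (1 + x\<^sub>k t)\<close>.

  For the step from \<open>k\<close> to \<open>m = k + 1\<close>, write \<open>x = x\<^sub>m\<close>. Since \<open>\<Theta>\<^sub>k(t) = \<Theta>\<^sub>m(t) / (1 + x t)\<close>, the ring
  \<open>R\<^sub>k\<close> is \<open>R\<^sub>m[x]\<close>. Since \<open>C(t) C(-t) = 1\<close>, the product \<open>\<Theta>\<^sub>m(t) \<Theta>\<^sub>m(-t)\<close> equals
  \<open>(1 - x\<^sub>1\<^sup>2 t\<^sup>2) \<cdots> (1 - x\<^sub>m\<^sup>2 t\<^sup>2)\<close>; its coefficients lie in \<open>R\<^sub>m\<close>, and so \<open>x\<close> is a root of a monic
  polynomial of degree \<open>2 m\<close> over \<open>R\<^sub>m\<close>. Hence a \<open>W\<^sub>m\<close>-invariant \<open>f\<close>, which lies in \<open>R\<^sub>k\<close> by the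
  induction hypothesis, is a sum of \<open>g\<^sub>j x\<^sup>j\<close> over \<open>j < 2 m\<close> with all \<open>g\<^sub>j\<close> in \<open>R\<^sub>m\<close>. The group \<open>W\<^sub>m\<close> fixes
  \<open>f\<close> and the \<open>g\<^sub>j\<close> and moves \<open>x\<close> to each of \<open>\<plusminus>x\<^sub>1, \<dots>, \<plusminus>x\<^sub>m\<close>. The polynomial with coefficients
  \<open>g\<^sub>j\<close>, with \<open>f\<close> subtracted from its constant term, therefore has degree less than \<open>2 m\<close> and these \<open>2 m\<close>
  elements as roots. If the differences of the roots are not zero divisors, the polynomial is zero
  (\<open>poly_eq_0_if_roots\<close>), and \<open>f = g\<^sub>0\<close> lies in \<open>R\<^sub>m\<close>.

  The differences are, up to sign, \<open>x\<^sub>i - x\<^sub>j\<close>, \<open>x\<^sub>i + x\<^sub>j\<close> and \<open>2 x\<^sub>i\<close>. The first two are not zero divisors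
  over any coefficient ring; for the last one the additive group of \<open>\<Gamma>\<close> must have no 2-torsion. This is
  \<open>gamma_two_torsion_free\<close>, and it holds because modulo 2 the relations of \<open>\<Gamma>\<close> become
  the squares of the variables, which form a regular sequence.
\<close>

section \<open>Coefficients of multiples of a monomial\<close>

lemma lookup_single_mult:
  fixes g :: "'a::comm_ring_1 mpoly"
  shows "Poly_Mapping.lookup (Poly_Mapping.single k a * g) (k + l) = a * Poly_Mapping.lookup g l"
proof -
  have "Poly_Mapping.single k a * g
      = Poly_Mapping.single k a * (\<Sum>m\<in>Poly_Mapping.keys g. Poly_Mapping.single m (Poly_Mapping.lookup g m))"
    by (simp flip: poly_mapping_eq_sum_single)
  also have "\<dots> = (\<Sum>m\<in>Poly_Mapping.keys g. Poly_Mapping.single (k + m) (a * Poly_Mapping.lookup g m))"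
    by (simp add: sum_distrib_left mult_single)
  finally show ?thesis
    by (auto simp: lookup_sum lookup_single when_def in_keys_iff)
qed

lemma lookup_2_mult: 
  fixes f :: "'a::comm_ring_1 mpoly"
  shows "Poly_Mapping.lookup (2 * f) m = 2 * Poly_Mapping.lookup f m"
  unfolding mult_2 by (rule lookup_add)

section \<open>The ring \<open>\<Gamma>\<close> has no 2-torsion\<close>

text \<open>
  The ideal generated by 2 and the squares of the first \<open>N\<close> variables. It is given by its monomials,
  so that the regularity of the squares modulo 2 can be read off from exponents
  (\<open>squares_mod_2_regular\<close>).
\<close>

definition squares_mod_2 :: "nat \<Rightarrow> int mpoly set" where
  "squares_mod_2 N =
     {f. \<forall>m. odd (Poly_Mapping.lookup f m) \<longrightarrow> (\<exists>i<N. Poly_Mapping.lookup m i \<ge> 2)}"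

text \<open>
  The ideal generated by the first \<open>N\<close> relations. The saturation argument removes one relation at a
  time, so it needs these truncations of \<open>gamma_ideal\<close>.
\<close>

definition relation_span :: "nat \<Rightarrow> int mpoly set" where
  "relation_span N = {f. \<exists>a. f = (\<Sum>i<N. a i * gamma_relation (Suc i))}"

lemma relation_spanI: "f = (\<Sum>i<N. a i * gamma_relation (Suc i)) \<Longrightarrow> f \<in> relation_span N"
  by (auto simp: relation_span_def)

lemma relation_span_0: "0 \<in> relation_span N"
  by (rule relation_spanI[of _ "\<lambda>_. 0"]) simp

lemma relation_span_add:
  assumes "f \<in> relation_span N" "g \<in> relation_span N"
  shows "f + g \<in> relation_span N"
proof -
  obtain a b where "f = (\<Sum>i<N. a i * gamma_relation (Suc i))" "g = (\<Sum>i<N. b i * gamma_relation (Suc i))"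
    using assms by (auto simp: relation_span_def)
  then have "f + g = (\<Sum>i<N. (a i + b i) * gamma_relation (Suc i))"
    by (simp add: sum.distrib ring_distribs)
  then show ?thesis by (rule relation_spanI)
qed

lemma relation_span_mult:
  assumes "f \<in> relation_span N"
  shows "g * f \<in> relation_span N"
proof -
  obtain a where "f = (\<Sum>i<N. a i * gamma_relation (Suc i))"
    using assms by (auto simp: relation_span_def)
  then have "g * f = (\<Sum>i<N. (g * a i) * gamma_relation (Suc i))"
    by (simp add: sum_distrib_left mult.assoc)
  then show ?thesis by (rule relation_spanI)
qed

lemma relation_span_Suc:
  "f \<in> relation_span (Suc N) \<longleftrightarrow> (\<exists>b. f - b * gamma_relation (Suc N) \<in> relation_span N)"
proof
  assume "f \<in> relation_span (Suc N)"
  then obtain a where "f = (\<Sum>i<Suc N. a i * gamma_relation (Suc i))"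
    by (auto simp: relation_span_def)
  then have "f - a N * gamma_relation (Suc N) = (\<Sum>i<N. a i * gamma_relation (Suc i))" by simp
  then show "\<exists>b. f - b * gamma_relation (Suc N) \<in> relation_span N"
    using relation_spanI by blast
next
  assume "\<exists>b. f - b * gamma_relation (Suc N) \<in> relation_span N"
  then obtain b a where "f - b * gamma_relation (Suc N) = (\<Sum>i<N. a i * gamma_relation (Suc i))"
    by (auto simp: relation_span_def)
  then have "f = (\<Sum>i<Suc N. (if i = N then b else a i) * gamma_relation (Suc i))"
    by (simp add: algebra_simps)
  then show "f \<in> relation_span (Suc N)" by (rule relation_spanI)
qed

lemma relation_span_mono: "f \<in> relation_span N \<Longrightarrow> N \<le> M \<Longrightarrow> f \<in> relation_span M"
proof (induction M)
  case (Suc M)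
  show ?case
  proof (cases "N = Suc M")
    case False
    then have "f - 0 * gamma_relation (Suc M) \<in> relation_span M" using Suc by simp
    then show ?thesis unfolding relation_span_Suc by blast
  qed (use Suc in simp)
qed simp

text \<open>
  An ideal membership uses only finitely many relations.
\<close>

lemma gamma_ideal_eq: "gamma_ideal = (\<Union>N. relation_span N)"
proof
  have "gamma_ideal \<subseteq> (\<Union>N. relation_span N)"
    unfolding gamma_ideal_def
  proof (rule module.span_minimal[OF module_self])
    show "gamma_relation ` {1..} \<subseteq> (\<Union>N. relation_span N)"
    proof
      fix f assume "f \<in> gamma_relation ` {1..}"
      then obtain p where "p \<ge> 1" "f = gamma_relation p" by auto
      then have "f - 1 * gamma_relation (Suc (p - 1)) \<in> relation_span (p - 1)"
        using relation_span_0 by simp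
      then show "f \<in> (\<Union>N. relation_span N)" using relation_span_Suc by blast
    qed
    show "module.subspace (*) (\<Union>N. relation_span N)"
      unfolding module.subspace_def[OF module_self]
    proof (intro conjI ballI allI)
      show "0 \<in> (\<Union>N. relation_span N)"
        using relation_span_0 by blast
      fix f g assume "f \<in> (\<Union>N. relation_span N)" "g \<in> (\<Union>N. relation_span N)"
      then obtain N M where "f \<in> relation_span N" "g \<in> relation_span M" by auto
      then have "f \<in> relation_span (max N M)" "g \<in> relation_span (max N M)"
        by (auto intro: relation_span_mono)
      then show "f + g \<in> (\<Union>N. relation_span N)" using relation_span_add by blast
    qed (auto intro: relation_span_mult)
  qed
  then show "gamma_ideal \<subseteq> (\<Union>N. relation_span N)" .
  show "(\<Union>N. relation_span N) \<subseteq> gamma_ideal"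
  proof
    fix f assume "f \<in> (\<Union>N. relation_span N)"
    then obtain N a where f: "f = (\<Sum>i<N. a i * gamma_relation (Suc i))"
      by (auto simp: relation_span_def)
    have "gamma_relation (Suc i) \<in> gamma_ideal" for i
      unfolding gamma_ideal_def by (rule module.span_base[OF module_self]) simp
    then show "f \<in> gamma_ideal"
      unfolding f gamma_ideal_def
      by (intro module.span_sum[OF module_self] module.span_scale[OF module_self])
  qed
qed

lemma gamma_relation_mod_2: "\<exists>s. gamma_relation (Suc i) = PVar i ^ 2 + 2 * s"
proof -
  have "csym (Suc i) = PVar i" by (simp add: csym_def)
  then show ?thesis unfolding gamma_relation_def by (simp only:) blast
qed

lemma squares_mod_2_add:
  "f \<in> squares_mod_2 N \<Longrightarrow> g \<in> squares_mod_2 N \<Longrightarrow> f + g \<in> squares_mod_2 N"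
  by (auto simp: squares_mod_2_def lookup_add)

lemma squares_mod_2_two: "2 * f \<in> squares_mod_2 N"
  by (auto simp: squares_mod_2_def lookup_2_mult)

lemma squares_mod_2_square:
  assumes "i < N"
  shows "f * PVar i ^ 2 \<in> squares_mod_2 N"
  unfolding squares_mod_2_def
proof (intro CollectI allI impI)
  fix m assume "odd (Poly_Mapping.lookup (f * PVar i ^ 2) m)"
  then have "m \<in> Poly_Mapping.keys (f * PVar i ^ 2)" by (auto simp: in_keys_iff)
  then obtain k where "m = k + Poly_Mapping.single i 2"
    using keys_mult[of f "PVar i ^ 2"] by (auto simp: PVar_power)
  then show "\<exists>i<N. 2 \<le> Poly_Mapping.lookup m i"
    using assms by (auto simp: lookup_add intro!: exI[of _ i])
qed

lemma relation_span_subset_squares_mod_2: "relation_span N \<subseteq> squares_mod_2 N"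
proof
  fix f assume "f \<in> relation_span N"
  then obtain a where f: "f = (\<Sum>i<N. a i * gamma_relation (Suc i))"
    by (auto simp: relation_span_def)
  have "a i * gamma_relation (Suc i) \<in> squares_mod_2 N" if "i < N" for i
  proof -
    obtain s where "gamma_relation (Suc i) = PVar i ^ 2 + 2 * s" using gamma_relation_mod_2 by blast
    then have "a i * gamma_relation (Suc i) = a i * PVar i ^ 2 + 2 * (a i * s)"
      by (simp add: algebra_simps)
    then show ?thesis
      using squares_mod_2_add[OF squares_mod_2_square[OF that] squares_mod_2_two] by metis
  qed
  moreover have "0 \<in> squares_mod_2 N" by (simp add: squares_mod_2_def)
  ultimately have "(\<Sum>i\<in>I. a i * gamma_relation (Suc i)) \<in> squares_mod_2 N" if "I \<subseteq> {..<N}" for I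
    using that by (induction I rule: infinite_finite_induct) (auto intro!: squares_mod_2_add)
  then show "f \<in> squares_mod_2 N" by (simp add: f)
qed

text \<open>
  Modulo 2 each square \<open>x\<^sub>i\<^sup>2\<close> with \<open>i < N\<close> can be exchanged for the relation with that leading square.
\<close>

lemma squares_mod_2_decompose:
  assumes "f \<in> squares_mod_2 N"
  shows "\<exists>u. f - 2 * u \<in> relation_span N"
proof -
  let ?D = "{f. \<exists>u. f - 2 * u \<in> relation_span N}"
  have add: "f + g \<in> ?D" if "f \<in> ?D" "g \<in> ?D" for f g
  proof -
    from that obtain u v where "f - 2 * u \<in> relation_span N" "g - 2 * v \<in> relation_span N" by auto
    then have "(f - 2 * u) + (g - 2 * v) \<in> relation_span N" by (rule relation_span_add)
    then have "(f + g) - 2 * (u + v) \<in> relation_span N" by (simp add: algebra_simps)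
    then show ?thesis by blast
  qed
  have zero: "0 \<in> ?D" using relation_span_0 by (auto intro!: exI[of _ 0])
  have mono: "Poly_Mapping.single m (Poly_Mapping.lookup f m) \<in> ?D" for m
  proof (cases "even (Poly_Mapping.lookup f m)")
    case True
    then obtain b where "Poly_Mapping.lookup f m = b + b" by (metis evenE mult_2)
    then have "Poly_Mapping.single m (Poly_Mapping.lookup f m) - 2 * Poly_Mapping.single m b = 0"
      by (simp only: mult_2 single_add diff_self)
    with relation_span_0 show ?thesis by (metis (mono_tags) mem_Collect_eq)
  next
    case False
    then obtain i where i: "i < N" "Poly_Mapping.lookup m i \<ge> 2"
      using assms by (auto simp: squares_mod_2_def)
    define k where "k = m - Poly_Mapping.single i 2"
    have m: "m = k + Poly_Mapping.single i 2"
      by (rule poly_mapping_eqI) (use i(2) in \<open>auto simp: k_def lookup_add lookup_minus lookup_single when_def\<close>)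
    obtain s where s: "gamma_relation (Suc i) = PVar i ^ 2 + 2 * s" using gamma_relation_mod_2 by blast
    define c where "c = Poly_Mapping.single k (Poly_Mapping.lookup f m)"
    have "Poly_Mapping.single m (Poly_Mapping.lookup f m) = c * PVar i ^ 2"
      by (simp add: c_def PVar_power mult_single flip: m)
    also have "\<dots> - 2 * (- (c * s)) = c * gamma_relation (Suc i)" by (simp add: s algebra_simps)
    also have "\<dots> = (\<Sum>j<N. (if j = i then c else 0) * gamma_relation (Suc j))"
      using i(1) by (simp add: if_distrib[of "\<lambda>x. x * _"] sum.delta cong: if_cong)
    also have "\<dots> \<in> relation_span N" by (rule relation_spanI) (rule refl)
    finally show ?thesis by blast
  qed
  have "(\<Sum>m\<in>M. Poly_Mapping.single m (Poly_Mapping.lookup f m)) \<in> ?D" for M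
  proof (induction M rule: infinite_finite_induct)
    case (insert m M)
    then show ?case using add[OF mono insert.IH] by simp
  qed (use zero in simp_all)
  from this[of "Poly_Mapping.keys f"] show ?thesis
    by (simp flip: poly_mapping_eq_sum_single)
qed

lemma squares_mod_2_regular:
  assumes "f * PVar N ^ 2 \<in> squares_mod_2 N"
  shows "f \<in> squares_mod_2 N"
  unfolding squares_mod_2_def
proof (intro CollectI allI impI)
  fix m assume "odd (Poly_Mapping.lookup f m)"
  then have "odd (Poly_Mapping.lookup (f * PVar N ^ 2) (Poly_Mapping.single N 2 + m))"
    by (simp add: PVar_power mult.commute[of f] lookup_single_mult)
  then obtain i where "i < N" "Poly_Mapping.lookup (Poly_Mapping.single N 2 + m) i \<ge> 2"
    using assms unfolding squares_mod_2_def by blast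
  then show "\<exists>i<N. 2 \<le> Poly_Mapping.lookup m i"
    by (auto simp: lookup_add lookup_single when_def)
qed

lemma mpoly_int_two_cancel:
  fixes f :: "int mpoly"
  assumes "2 * f = 0"
  shows "f = 0"
  by (rule poly_mapping_eqI) (use assms lookup_2_mult[of f] in simp)

text \<open>
  Suppose that \<open>2 f\<close> is a combination of relations in which the last relation \<open>r\<close> has the coefficient
  \<open>b\<close>. Modulo 2 this says that \<open>b x\<^sub>N\<^sup>2\<close> lies in the ideal of the earlier squares; by regularity so
  does \<open>b\<close>. Hence \<open>b = 2 u\<close> up to a combination of the earlier relations, and the induction hypothesis
  applies to \<open>f - u r\<close>.
\<close>

lemma relation_span_two_saturated: "2 * f \<in> relation_span N \<Longrightarrow> f \<in> relation_span N"
proof (induction N arbitrary: f)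
  case 0
  then show ?case using mpoly_int_two_cancel by (auto simp: relation_span_def)
next
  case (Suc N)
  let ?r = "gamma_relation (Suc N)"
  obtain b where b: "2 * f - b * ?r \<in> relation_span N"
    using Suc.prems unfolding relation_span_Suc by blast
  obtain s where s: "?r = PVar N ^ 2 + 2 * s" using gamma_relation_mod_2 by blast
  have "(- 1) * (2 * f - b * ?r) + 2 * (f - b * s) \<in> squares_mod_2 N"
    using squares_mod_2_add[OF _ squares_mod_2_two] relation_span_mult[OF b]
      relation_span_subset_squares_mod_2 by blast
  then have "b * PVar N ^ 2 \<in> squares_mod_2 N" by (simp add: s algebra_simps)
  then obtain u where u: "b - 2 * u \<in> relation_span N"
    using squares_mod_2_decompose squares_mod_2_regular by blast
  have "(2 * f - b * ?r) + ?r * (b - 2 * u) \<in> relation_span N"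
    by (intro relation_span_add relation_span_mult b u)
  then have "2 * (f - u * ?r) \<in> relation_span N" by (simp add: algebra_simps)
  then have "f - u * ?r \<in> relation_span N" by (rule Suc.IH)
  then show ?case unfolding relation_span_Suc by blast
qed

theorem gamma_two_torsion_free:
  fixes a :: gamma
  assumes "2 * a = 0"
  shows "a = 0"
proof -
  obtain q where a: "a = abs_gamma q" using gamma_exhaust by blast
  have "abs_gamma (2 * q) = 0"
    using assms by (simp add: a homD(6)[OF abs_gamma_hom] hom_two[OF abs_gamma_hom])
  then have "2 * q \<in> gamma_ideal" by (simp add: zero_gamma.abs_eq gamma.abs_eq_iff)
  then have "q \<in> gamma_ideal"
    unfolding gamma_ideal_eq using relation_span_two_saturated by blast
  then show ?thesis by (simp add: a zero_gamma.abs_eq gamma.abs_eq_iff)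
qed

section \<open>Polynomials with too many roots\<close>

definition non_zero_divisor :: "'a::comm_ring_1 \<Rightarrow> bool" where
  "non_zero_divisor u \<longleftrightarrow> (\<forall>g. u * g = 0 \<longrightarrow> g = 0)"

lemma non_zero_divisor_uminus: "non_zero_divisor (- u) \<longleftrightarrow> non_zero_divisor u"
  by (simp add: non_zero_divisor_def)

text \<open>
  The usual bound on the number of roots holds over rings with zero divisors as long as the
  differences of the roots can be cancelled: splitting off the root \<open>r a\<close> leaves a factor at which every
  other \<open>r b\<close> is still a root, because \<open>r b - r a\<close> cancels.
\<close>

lemma poly_eq_0_if_roots:
  fixes p :: "'a::comm_ring_1 poly"
  assumes "finite A" "degree p < card A" "\<And>a. a \<in> A \<Longrightarrow> poly p (r a) = 0"
    and "\<And>a b. a \<in> A \<Longrightarrow> b \<in> A \<Longrightarrow> a \<noteq> b \<Longrightarrow> non_zero_divisor (r a - r b)"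
  shows "p = 0"
  using assms
proof (induction A arbitrary: p rule: finite_induct)
  case (insert a A)
  define q where "q = synthetic_div p (r a)"
  have p: "p = [:- r a, 1:] * q"
    using synthetic_div_correct'[of "r a" p] insert.prems(2)[of a] by (simp add: q_def)
  show ?case
  proof (cases "degree p = 0")
    case True
    then have "q = 0" by (simp add: q_def synthetic_div_eq_0_iff)
    then show ?thesis by (simp add: p)
  next
    case False
    have "q = 0"
    proof (rule insert.IH)
      show "degree q < card A"
        using insert False by (simp add: q_def degree_synthetic_div)
      fix b assume b: "b \<in> A"
      have "(r b - r a) * poly q (r b) = poly p (r b)" by (subst p) (simp add: algebra_simps)
      also have "\<dots> = 0" using insert.prems(2) b by simp
      finally show "poly q (r b) = 0"
        using insert.prems(3)[of b a] insert.hyps b by (auto simp: non_zero_divisor_def)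
    qed (use insert.prems in auto)
    then show ?thesis by (simp add: p)
  qed
qed simp

lemma non_zero_divisor_two_PVar:
  assumes "\<And>a :: 'a. 2 * a = 0 \<Longrightarrow> a = 0"
  shows "non_zero_divisor (2 * PVar i :: 'a::comm_ring_1 mpoly)"
  unfolding non_zero_divisor_def
proof (intro allI impI)
  fix g :: "'a mpoly" assume g: "2 * PVar i * g = 0"
  show "g = 0"
  proof (rule poly_mapping_eqI)
    fix m
    have "2 * Poly_Mapping.lookup g m = Poly_Mapping.lookup (2 * (PVar i * g)) (Poly_Mapping.single i 1 + m)"
      unfolding lookup_2_mult by (simp only: PVar_def lookup_single_mult mult_1)
    also have "\<dots> = 0" using g by (simp add: mult.assoc)
    finally show "Poly_Mapping.lookup g m = Poly_Mapping.lookup 0 m" using assms by simp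
  qed
qed

text \<open>
  The product of \<open>x\<^sub>i + e x\<^sub>j\<close> with a nonzero \<open>g\<close> contains \<open>x\<^sub>i m\<close>, for \<open>m\<close> a monomial of \<open>g\<close> of the
  highest degree in \<open>x\<^sub>i\<close>; the summand \<open>e x\<^sub>j g\<close> has too low a degree in \<open>x\<^sub>i\<close> to cancel it.
\<close>

lemma non_zero_divisor_PVar_add_multiple:
  assumes "i \<noteq> j"
  shows "non_zero_divisor (PVar i + PConst e * PVar j :: 'a::comm_ring_1 mpoly)"
  unfolding non_zero_divisor_def
proof (intro allI impI, rule ccontr)
  fix g :: "'a mpoly" assume 0: "(PVar i + PConst e * PVar j) * g = 0" and "g \<noteq> 0"
  then have ne: "Poly_Mapping.keys g \<noteq> {}" by simp
  let ?deg = "\<lambda>m. Poly_Mapping.lookup m i"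
  define d where "d = Max (?deg ` Poly_Mapping.keys g)"
  have "d \<in> ?deg ` Poly_Mapping.keys g" unfolding d_def by (rule Max_in) (use ne in auto)
  then obtain m where m: "m \<in> Poly_Mapping.keys g" "?deg m = d" by auto
  have max: "?deg k \<le> d" if "k \<in> Poly_Mapping.keys g" for k
    unfolding d_def by (rule Max_ge) (use that in auto)
  let ?k = "Poly_Mapping.single i 1 + m"
  have "Poly_Mapping.lookup (PConst e * PVar j * g) ?k = 0"
  proof (rule ccontr)
    assume "Poly_Mapping.lookup (PConst e * PVar j * g) ?k \<noteq> 0"
    then have "?k \<in> Poly_Mapping.keys (Poly_Mapping.single (Poly_Mapping.single j 1) e * g)"
      by (simp add: PConst_def PVar_def mult_single in_keys_iff)
    then obtain l where l: "l \<in> Poly_Mapping.keys g" "?k = Poly_Mapping.single j 1 + l"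
      using keys_mult[of "Poly_Mapping.single (Poly_Mapping.single j 1) e" g] by (auto split: if_splits)
    from arg_cong[OF l(2), of ?deg] have "?deg l = Suc d"
      using assms m by (simp add: lookup_add lookup_single)
    with max[OF l(1)] show False by simp
  qed
  moreover have "Poly_Mapping.lookup (PVar i * g) ?k = Poly_Mapping.lookup g m"
    by (simp only: PVar_def lookup_single_mult mult_1)
  moreover have "Poly_Mapping.lookup (PVar i * g + PConst e * PVar j * g) ?k = 0"
    using 0 by (simp add: ring_distribs)
  ultimately show False using m(1) by (simp add: lookup_add in_keys_iff)
qed

lemma non_zero_divisor_signed_X_diff:
  assumes "a \<noteq> 0" "b \<noteq> 0" "a \<noteq> b"
  shows "non_zero_divisor (signed_X a - signed_X b)"
proof -
  define i j where "i = nat \<bar>a\<bar>" and "j = nat \<bar>b\<bar>"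
  have two: "non_zero_divisor (2 * X i)"
    by (rule non_zero_divisor_two_PVar) (rule gamma_two_torsion_free)
  have ij: "non_zero_divisor (X i + X j)" "non_zero_divisor (X i - X j)" if "i \<noteq> j"
    using non_zero_divisor_PVar_add_multiple[OF that, of 1]
      non_zero_divisor_PVar_add_multiple[OF that, of "- 1"]
    by (simp_all add: homD[OF PConst_hom])
  have "signed_X a = (if a > 0 then X i else - X i)" "signed_X b = (if b > 0 then X j else - X j)"
    using assms by (auto simp: signed_X_def i_def j_def)
  then have *: "signed_X a - signed_X b \<in> {X i - X j, X i + X j, - (X i + X j), - (X i - X j)}"
    by auto
  show ?thesis
  proof (cases "i = j")
    case False
    with * ij show ?thesis using non_zero_divisor_uminus by (metis empty_iff insertE)
  next
    case True
    then have "b = - a" using assms by (auto simp: i_def j_def)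
    then have "signed_X a - signed_X b \<in> {2 * X i, - (2 * X i)}"
      using assms by (auto simp: signed_X_def i_def)
    with two show ?thesis using non_zero_divisor_uminus by (metis empty_iff insertE)
  qed
qed


section \<open>Generating functions of theta polynomials\<close>

lemma prod_lin_nth:
  fixes a :: "'i \<Rightarrow> 'b::comm_ring_1"
  assumes "finite I"
  shows "fps_nth (\<Prod>i\<in>I. lin (a i)) j = (\<Sum>S | S \<subseteq> I \<and> card S = j. \<Prod>i\<in>S. a i)"
proof -
  have S: "(\<Prod>i\<in>S. fps_const (a i) * fps_X) = fps_const (\<Prod>i\<in>S. a i) * fps_X ^ card S" for S
    by (induction S rule: infinite_finite_induct)
      (simp_all add: ac_simps flip: fps_const_mult)
  have "(\<Prod>i\<in>I. lin (a i)) = (\<Prod>i\<in>I. fps_const (a i) * fps_X + 1)"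
    by (simp add: lin_def add.commute)
  also have "\<dots> = (\<Sum>S\<in>Pow I. fps_const (\<Prod>i\<in>S. a i) * fps_X ^ card S)"
    by (subst prod_add[OF assms]) (simp add: S)
  finally have "fps_nth (\<Prod>i\<in>I. lin (a i)) j = (\<Sum>S\<in>Pow I. if card S = j then \<Prod>i\<in>S. a i else 0)"
    by (simp add: fps_sum_nth fps_X_power_nth if_distrib[of "\<lambda>x. _ * x"] eq_commute[of j] cong: if_cong)
  also have "\<dots> = (\<Sum>S | S \<subseteq> I \<and> card S = j. \<Prod>i\<in>S. a i)"
    using assms by (subst sum.inter_filter[symmetric]) (auto intro: sum.cong)
  finally show ?thesis .
qed

lemma prod_lin_nth_eq_0:
  assumes "finite I" "j > card I"
  shows "fps_nth (\<Prod>i\<in>I. lin (a i)) j = 0"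
proof -
  have "{S. S \<subseteq> I \<and> card S = j} = {}" using card_mono[OF assms(1)] assms(2) by (auto simp: not_le[symmetric])
  then show ?thesis by (simp only: prod_lin_nth[OF assms(1)] sum.empty)
qed

lemma prod_lin_nth_0: "fps_nth (\<Prod>i\<in>I. lin (a i)) 0 = 1"
  by (induction I rule: infinite_finite_induct) (simp_all add: lin_nth)

definition theta_fps :: "nat \<Rightarrow> gamma mpoly fps" where
  "theta_fps k = C_fps * (\<Prod>i=1..k. lin (X i))"

lemma theta_fps_nth: "fps_nth (theta_fps k) p = theta_c k p"
proof -
  have "fps_nth (theta_fps k) p = (\<Sum>j=0..p. elem_sym k j * C (p - j))"
    unfolding theta_fps_def mult.commute[of C_fps] fps_mult_nth
    by (simp add: prod_lin_nth C_fps_def elem_sym_def)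
  then show ?thesis by (simp add: theta_c_def mult.commute)
qed

lemma theta_c_0 [simp]: "theta_c k 0 = 1"
  unfolding theta_fps_nth[symmetric] by (simp add: theta_fps_def C_fps_def prod_lin_nth_0)

lemma theta_fps_alt:
  "theta_fps k * fps_alt (theta_fps k) = (\<Prod>i=1..k. lin (X i)) * (\<Prod>i=1..k. lin (- X i))"
proof -
  have "theta_fps k * fps_alt (theta_fps k)
      = (C_fps * fps_alt C_fps) * ((\<Prod>i=1..k. lin (X i)) * (\<Prod>i=1..k. lin (- X i)))"
    by (simp only: theta_fps_def fps_alt_mult fps_alt_prod fps_alt_lin ac_simps)
  then show ?thesis by (simp add: C_fps_alt)
qed

text \<open>
  The product \<open>\<Theta>(t) \<Theta>(-t)\<close> is divisible by \<open>1 - x t\<close> with \<open>x\<close> the last variable, so that its reversed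
  polynomial vanishes at \<open>x\<close>. In terms of power series: multiplication by \<open>1 / (1 - x t)\<close> leaves a
  product of \<open>2 k + 1\<close> linear factors, whose coefficient of degree \<open>2 (k + 1)\<close> is zero.
\<close>

lemma X_root:
  "(\<Sum>j=0..2 * Suc k. fps_nth (theta_fps (Suc k) * fps_alt (theta_fps (Suc k))) j
     * X (Suc k) ^ (2 * Suc k - j)) = 0"
proof -
  let ?f = "\<Prod>i=1..Suc k. lin (X i)" and ?g = "\<Prod>i=1..k. lin (- X i)"
  have "theta_fps (Suc k) * fps_alt (theta_fps (Suc k)) * geo (X (Suc k))
      = ?f * ?g * (lin (- X (Suc k)) * geo (X (Suc k)))"
    unfolding theta_fps_alt by (simp add: mult.assoc)
  then have eq: "theta_fps (Suc k) * fps_alt (theta_fps (Suc k)) * geo (X (Suc k)) = ?f * ?g"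
    by (simp only: lin_geo mult_1_right)
  \<comment> \<open>The degrees of the factors are at most \<open>k + 1\<close> and \<open>k\<close>, so one of the indices is too large.\<close>
  have "fps_nth ?f j * fps_nth ?g (2 * Suc k - j) = 0" for j
    using prod_lin_nth_eq_0[of "{1..Suc k}" j X]
      prod_lin_nth_eq_0[of "{1..k}" "2 * Suc k - j" "\<lambda>i. - X i"]
    by (cases "j > Suc k") auto
  then have "fps_nth (?f * ?g) (2 * Suc k) = 0" unfolding fps_mult_nth by (simp only: sum.neutral_const)
  then show ?thesis unfolding eq[symmetric] fps_mult_nth[of _ "geo _"] geo_nth .
qed

section \<open>Subrings generated by an integral element\<close>

lemma generated_subring_subring: "subring_set (generated_subring S)"
  by (auto simp: generated_subring_def subring_set_def)

lemma generated_subring_superset: "S \<subseteq> generated_subring S"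
  by (auto simp: generated_subring_def)

lemma generated_subring_minimal: "subring_set A \<Longrightarrow> S \<subseteq> A \<Longrightarrow> generated_subring S \<subseteq> A"
  by (auto simp: generated_subring_def)

definition power_span :: "'a::comm_ring_1 set \<Rightarrow> 'a \<Rightarrow> nat \<Rightarrow> 'a set" where
  "power_span K x N = {f. \<exists>g. (\<forall>j. g j \<in> K) \<and> f = (\<Sum>j<N. g j * x ^ j)}"

lemma power_spanI: "(\<And>j. g j \<in> K) \<Longrightarrow> f = (\<Sum>j<N. g j * x ^ j) \<Longrightarrow> f \<in> power_span K x N"
  by (auto simp: power_span_def)

lemma power_spanE:
  assumes "f \<in> power_span K x N"
  obtains g where "\<And>j. g j \<in> K" "f = (\<Sum>j<N. g j * x ^ j)"
  using assms by (auto simp: power_span_def)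

text \<open>
  The combinations of \<open>1, x, \<dots>, x\<^sup>N\<^sup>-\<^sup>1\<close> form a module over \<open>K\<close>, and the relation for \<open>x\<^sup>N\<close> makes it stable
  under multiplication by \<open>x\<close>. The elements that stabilize this module form a ring containing \<open>K\<close> and \<open>x\<close>;
  such an element is recovered from its product with 1.
\<close>

lemma generated_subring_insert_subset_power_span:
  assumes K: "subring_set K" and N: "N \<ge> 1" and x: "x ^ N \<in> power_span K x N"
  shows "generated_subring (insert x K) \<subseteq> power_span K x N"
proof
  let ?L = "power_span K x N"
  have diff: "f - f' \<in> ?L" if "f \<in> ?L" "f' \<in> ?L" for f f'
  proof -
    from that obtain g g' where g: "\<And>j. g j \<in> K" "f = (\<Sum>j<N. g j * x ^ j)"
      and g': "\<And>j. g' j \<in> K" "f' = (\<Sum>j<N. g' j * x ^ j)" by (elim power_spanE) blast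
    show ?thesis
      by (rule power_spanI[of "\<lambda>j. g j - g' j"])
        (simp_all add: g g' subring_setD[OF K] sum_subtractf left_diff_distrib)
  qed
  have scale: "a * f \<in> ?L" if "a \<in> K" "f \<in> ?L" for a f
  proof -
    from that(2) obtain g where g: "\<And>j. g j \<in> K" "f = (\<Sum>j<N. g j * x ^ j)" by (elim power_spanE) blast
    show ?thesis
      by (rule power_spanI[of "\<lambda>j. a * g j"])
        (simp_all add: g that(1) subring_setD[OF K] sum_distrib_left mult.assoc)
  qed
  have shift: "x * f \<in> ?L" if "f \<in> ?L" for f
  proof -
    from that obtain g where g: "\<And>j. g j \<in> K" "f = (\<Sum>j<N. g j * x ^ j)" by (elim power_spanE) blast
    obtain M where M: "N = Suc M" using N by (cases N) auto
    have "x * f = (\<Sum>j<N. g j * x ^ Suc j)" by (simp add: g sum_distrib_left ac_simps)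
    also have "\<dots> = (\<Sum>j<M. g j * x ^ Suc j) + g M * x ^ N" by (simp add: M)
    also have "(\<Sum>j<M. g j * x ^ Suc j) = (\<Sum>j<N. (case j of 0 \<Rightarrow> 0 | Suc i \<Rightarrow> g i) * x ^ j)"
      unfolding M sum.lessThan_Suc_shift by simp
    finally have eq: "x * f = (\<Sum>j<N. (case j of 0 \<Rightarrow> 0 | Suc i \<Rightarrow> g i) * x ^ j) - (- g M) * x ^ N"
      by simp
    have "(\<Sum>j<N. (case j of 0 \<Rightarrow> 0 | Suc i \<Rightarrow> g i) * x ^ j) \<in> ?L"
      by (rule power_spanI[OF _ refl]) (auto simp: g subring_setD[OF K] split: nat.split)
    then show ?thesis unfolding eq by (intro diff scale x subring_setD(4)[OF K] g)
  qed
  have one: "1 \<in> ?L"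
    by (rule power_spanI[of "\<lambda>j. if j = 0 then 1 else 0"])
      (use N in \<open>auto simp: subring_setD[OF K] if_distrib[of "\<lambda>y. y * _"] sum.delta cong: if_cong\<close>)
  have "subring_set {t. \<forall>f\<in>?L. t * f \<in> ?L}"
    by (auto simp: subring_set_def left_diff_distrib mult.assoc diff)
  then have "generated_subring (insert x K) \<subseteq> {t. \<forall>f\<in>?L. t * f \<in> ?L}"
    by (rule generated_subring_minimal) (auto intro: scale shift)
  moreover fix t assume "t \<in> generated_subring (insert x K)"
  ultimately have "t * 1 \<in> ?L" using one by blast
  then show "t \<in> ?L" by simp
qed

section \<open>The rings between \<open>\<Gamma>[X\<^sub>n]\<close> and the ring of theta polynomials\<close>

definition partial_theta :: "nat \<Rightarrow> nat \<Rightarrow> gamma mpoly set" where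
  "partial_theta n k = generated_subring (theta_c k ` {1..} \<union> X ` {k+1..n})"

lemma partial_theta_subring: "subring_set (partial_theta n k)"
  by (simp add: partial_theta_def generated_subring_subring)

lemma theta_c_in_partial_theta: "theta_c k p \<in> partial_theta n k"
proof (cases "p = 0")
  case False
  then show ?thesis
    unfolding partial_theta_def by (intro subsetD[OF generated_subring_superset]) auto
qed (simp add: subring_setD[OF partial_theta_subring])

lemma X_in_partial_theta: "i \<in> {k+1..n} \<Longrightarrow> X i \<in> partial_theta n k"
  unfolding partial_theta_def by (intro subsetD[OF generated_subring_superset]) auto

lemma fps_in_alt: "subring_set A \<Longrightarrow> f \<in> fps_in A \<Longrightarrow> fps_alt f \<in> fps_in A"
  unfolding fps_in_def fps_alt_def
  by (auto intro!: subring_setD(6) subring_set_power subring_setD(4) subring_setD(1))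

lemma theta_fps_in: "theta_fps k \<in> fps_in (partial_theta n k)"
  by (simp add: fps_in_def theta_fps_nth theta_c_in_partial_theta)

text \<open>
  The level \<open>k\<close> arises from level \<open>k + 1\<close> by adjoining \<open>x\<^sub>k\<^sub>+\<^sub>1\<close>, which is integral of degree \<open>2 (k + 1)\<close>
  by \<open>X_root\<close>.
\<close>

lemma partial_theta_subset_power_span:
  assumes "k < n"
  shows "partial_theta n k \<subseteq> power_span (partial_theta n (Suc k)) (X (Suc k)) (2 * Suc k)"
proof -
  let ?K = "partial_theta n (Suc k)" and ?x = "X (Suc k)"
  let ?N = "2 * Suc k" and ?R = "generated_subring (insert ?x ?K)"
  note K = partial_theta_subring[of n "Suc k"] and R = generated_subring_subring[of "insert ?x ?K"]
  have KR: "?K \<subseteq> ?R" and xR: "?x \<in> ?R" using generated_subring_superset by blast+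
  have "theta_fps k = theta_fps (Suc k) * geo (- ?x)"
  proof -
    have "theta_fps (Suc k) * geo (- ?x) = theta_fps k * (lin ?x * geo (- ?x))"
      by (simp add: theta_fps_def mult.assoc)
    then show ?thesis by (simp only: lin_geo mult_1_right)
  qed
  also have "\<dots> \<in> fps_in ?R"
    using theta_fps_in[of "Suc k" n] KR
    by (intro fps_in_mult[OF R] fps_in_geo[OF R] subring_setD(4)[OF R] xR) (auto simp: fps_in_def)
  finally have "theta_c k p \<in> ?R" for p by (simp add: fps_in_def theta_fps_nth)
  moreover have "X i \<in> ?R" if "i \<in> {k+1..n}" for i
    using that xR KR X_in_partial_theta[of i "Suc k" n] by (cases "i = Suc k") auto
  ultimately have "partial_theta n k \<subseteq> ?R"
    unfolding partial_theta_def[of n k] by (intro generated_subring_minimal[OF R]) auto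
  also have "?R \<subseteq> power_span ?K ?x ?N"
  proof (rule generated_subring_insert_subset_power_span[OF K])
    \<comment> \<open>The coefficients of the monic equation, in reversed order.\<close>
    define A where "A = theta_fps (Suc k) * fps_alt (theta_fps (Suc k))"
    have A: "fps_nth A j \<in> ?K" for j
      using fps_in_mult[OF K theta_fps_in fps_in_alt[OF K theta_fps_in]]
      by (simp add: A_def fps_in_def)
    have A0: "fps_nth A 0 = 1"
      by (simp add: A_def fps_alt_def theta_fps_nth)
    have "(\<Sum>j=0..?N. fps_nth A (?N - j) * ?x ^ j) = (\<Sum>j=0..?N. fps_nth A j * ?x ^ (?N - j))"
      by (rule sum.reindex_bij_witness[of _ "\<lambda>j. ?N - j" "\<lambda>j. ?N - j"]) auto
    also have "\<dots> = 0" using X_root[of k] by (simp only: A_def)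
    also have "{0..?N} = insert ?N {..<?N}" by auto
    finally have "?x ^ ?N + (\<Sum>j<?N. fps_nth A (?N - j) * ?x ^ j) = 0" 
      by (subst (asm) sum.insert) (simp_all add: A0 del: power_Suc mult_Suc_right)
    then have "?x ^ ?N = - (\<Sum>j<?N. fps_nth A (?N - j) * ?x ^ j)"
      by (simp only: eq_neg_iff_add_eq_0)
    also have "\<dots> = (\<Sum>j<?N. (- fps_nth A (?N - j)) * ?x ^ j)"
      by (simp only: sum_negf mult_minus_left)
    finally show "?x ^ ?N \<in> power_span ?K ?x ?N"
      by (rule power_spanI[rotated]) (intro subring_setD(4)[OF K] A)
  qed simp
  finally show ?thesis .
qed

section \<open>Invariants\<close>

lemma signed_perms_mono: "w \<in> signed_perms k \<Longrightarrow> k \<le> n \<Longrightarrow> w \<in> signed_perms n"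
  unfolding signed_perms_def by (auto elim: permutes_subset)

lemma signed_perms_outside: "w \<in> signed_perms k \<Longrightarrow> i > k \<Longrightarrow> w (int i) = int i"
  unfolding signed_perms_def by (auto intro: permutes_not_in)

text \<open>
  A signed permutation \<open>w\<close> of \<open>1, \<dots>, k\<close> multiplies \<open>C(t)\<close> by the product of the
  \<open>(1 + x\<^sub>i t) / (1 + w(x\<^sub>i) t)\<close>, which is what keeps \<open>C(t) (1 + x\<^sub>1 t) \<cdots> (1 + x\<^sub>k t)\<close> fixed.
\<close>

lemma weyl_map_partial_theta:
  assumes w: "w \<in> signed_perms k" and "k \<le> n" and f: "f \<in> partial_theta n k"
  shows "weyl_map n w f = f"
proof -
  have wn: "w \<in> signed_perms n" using assms by (blast intro: signed_perms_mono)
  note h = weyl_map_hom[OF wn]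
  have "weyl_factor n w = (\<Prod>i=1..k. lin (X i) * geo (- signed_X (w (int i))))"
    unfolding weyl_factor_def
    by (rule prod.mono_neutral_right)
      (use assms in \<open>auto simp: signed_perms_outside[OF w] not_le\<close>)
  then have "weyl_factor n w * (\<Prod>i=1..k. lin (signed_X (w (int i))))
      = (\<Prod>i=1..k. lin (X i) * (lin (signed_X (w (int i))) * geo (- signed_X (w (int i)))))"
    by (simp only: prod.distrib ac_simps)
  then have fac: "weyl_factor n w * (\<Prod>i=1..k. lin (signed_X (w (int i)))) = (\<Prod>i=1..k. lin (X i))"
    by (simp only: lin_geo mult_1_right)
  have "fps_map (weyl_map n w) C_fps = C_fps * weyl_factor n w"
    by (rule fps_ext) (simp add: fps_map_def C_fps_def weyl_map_C[OF wn] weyl_C_def)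
  then have "fps_map (weyl_map n w) (theta_fps k) = theta_fps k"
    by (simp add: theta_fps_def fps_map_mult[OF h] fps_map_prod[OF h] fps_map_lin[OF h]
        weyl_map_X[OF wn] mult.assoc fac[simplified])
  then have "fps_nth (fps_map (weyl_map n w) (theta_fps k)) p = fps_nth (theta_fps k) p" for p
    by simp
  then have theta: "weyl_map n w (theta_c k p) = theta_c k p" for p
    by (simp add: fps_map_def theta_fps_nth)
  have "ring_hom_on UNIV (\<lambda>f :: gamma mpoly. f)" by (simp add: ring_hom_on_def)
  from hom_equalizer_subring[OF h this subring_set_UNIV]
  have "partial_theta n k \<subseteq> {f \<in> UNIV. weyl_map n w f = f}"
    unfolding partial_theta_def
    by (rule generated_subring_minimal)
      (auto simp: theta weyl_map_X[OF wn] signed_perms_outside[OF w])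
  with f show ?thesis by blast
qed

lemma signed_perm_exists:
  assumes "a \<noteq> 0" "\<bar>a\<bar> \<le> int m" "m \<ge> 1"
  shows "\<exists>w\<in>signed_perms m. w (int m) = a"
proof -
  define w where "w = (if a = - int m then transpose (int m) (- int m)
    else transpose (int m) a \<circ> transpose (- int m) (- a))"
  have "w permutes {- int m..int m}"
    using assms by (auto simp: w_def intro!: permutes_compose permutes_swap_id)
  moreover have "w (- j) = - w j" for j
    using assms by (auto simp: w_def transpose_def)
  moreover have "w (int m) = a"
    using assms by (auto simp: w_def transpose_def)
  ultimately show ?thesis by (auto simp: signed_perms_def)
qed

text \<open>
  In the inductive step, the conjugates of \<open>x\<^sub>k\<^sub>+\<^sub>1\<close> under the signed permutations of \<open>1, \<dots>, k + 1\<close> are as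
  many as the number of powers of \<open>x\<^sub>k\<^sub>+\<^sub>1\<close> that are needed to express the invariant; this forces the
  expression to be its constant term.
\<close>

lemma invariant_in_partial_theta:
  assumes "k \<le> n" "f \<in> gamma_polys n" "\<And>w. w \<in> signed_perms k \<Longrightarrow> weyl_map n w f = f"
  shows "f \<in> partial_theta n k"
  using assms(1,3)
proof (induction k)
  case 0
  have "C p \<in> partial_theta n 0" for p
    using theta_c_in_partial_theta[of 0 p n]
    by (simp add: theta_fps_def C_fps_def flip: theta_fps_nth)
  then have "gamma_polys n \<subseteq> partial_theta n 0"
    by (intro gamma_polys_subset partial_theta_subring) (auto intro: X_in_partial_theta)
  with assms(2) show ?case by blast
next
  case (Suc k)
  let ?K = "partial_theta n (Suc k)" and ?N = "2 * Suc k" and ?m = "int (Suc k)"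
  have "f \<in> partial_theta n k"
  proof (rule Suc.IH)
    fix w assume "w \<in> signed_perms k"
    then show "weyl_map n w f = f" using signed_perms_mono[of w k "Suc k"] by (intro Suc.prems(2)) simp
  next
    show "k \<le> n" using Suc.prems(1) by simp
  qed
  moreover have "k < n" using Suc.prems(1) by simp
  ultimately have "f \<in> power_span ?K (X (Suc k)) ?N"
    by (rule subsetD[OF partial_theta_subset_power_span, rotated])
  then obtain g where g: "\<And>j. g j \<in> ?K" "f = (\<Sum>j<?N. g j * X (Suc k) ^ j)"
    by (rule power_spanE) blast
  define p where "p = (\<Sum>j<?N. monom (g j) j) - [:f:]"
  let ?A = "{- ?m..?m} - {0}"
  have coeff: "coeff p j = (if j < ?N then g j else 0) - (if j = 0 then f else 0)" for j
    by (simp add: p_def coeff_sum coeff_pCons split: nat.split)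
  have "p = 0"
  proof (rule poly_eq_0_if_roots[of ?A _ signed_X])
    have "card ?A = ?N" by (subst card_Diff_subset) auto
    moreover have "degree p < ?N"
      by (rule degree_lessI) (auto simp: coeff)
    ultimately show "degree p < card ?A" by simp
    fix a assume a: "a \<in> ?A"
    then have "a \<noteq> 0" "\<bar>a\<bar> \<le> ?m" by auto
    from signed_perm_exists[OF this] obtain w where w: "w \<in> signed_perms (Suc k)" "w ?m = a" by auto
    have wn: "w \<in> signed_perms n" using w Suc.prems(1) by (blast intro: signed_perms_mono)
    note h = weyl_map_hom[OF wn]
    have "f = weyl_map n w (\<Sum>j<?N. g j * X (Suc k) ^ j)" using Suc.prems(2)[OF w(1)] g(2) by simp
    also have "\<dots> = (\<Sum>j<?N. g j * signed_X a ^ j)"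
      unfolding hom_sum[OF h] homD(6)[OF h] hom_power[OF h] weyl_map_X[OF wn] w(2)
      by (simp only: weyl_map_partial_theta[OF w(1) Suc.prems(1) g(1)])
    finally show "poly p (signed_X a) = 0"
      by (simp add: p_def poly_sum poly_monom)
  qed (auto intro!: non_zero_divisor_signed_X_diff)
  then have "g 0 = f" using coeff[of 0] by simp
  with g(1) show ?case by metis
qed

theorem proposition6:
  fixes n :: nat
  assumes "n \<ge> 1"
  shows "theta_ring n = weyl_invariants n"
proof -
  have K: "theta_ring n = partial_theta n n"
    by (simp add: theta_ring_def partial_theta_def)
  have action: "weyl_action n w f = weyl_map n w f" if "w \<in> signed_perms n" "f \<in> gamma_polys n" for w f
    using weyl_action_unique[OF assms is_weyl_action_weyl_map[OF assms] that] .
  have "theta_fps n \<in> fps_in (gamma_polys n)"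
    unfolding theta_fps_def
    by (intro fps_in_mult fps_in_prod fps_in_lin gamma_polys_subring X_in_gamma_polys)
      (auto simp: fps_in_def C_fps_def PConst_in_gamma_polys)
  then have "theta_ring n \<subseteq> gamma_polys n"
    unfolding theta_ring_def
    by (intro generated_subring_minimal gamma_polys_subring) (auto simp: fps_in_def theta_fps_nth)
  then show ?thesis
    unfolding weyl_invariants_def K
    using weyl_map_partial_theta[of _ n n] invariant_in_partial_theta[of n n] action by auto
qed

end
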